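(* Let $\mathfrak{A}$ be a complex unital $C^*$-algebra and let $a\in\mathfrak{A}$ be a non-zero positive element. Let $k\ge 1$, let $x_1,\dots,x_k,y_1,\dots,y_k\in\mathfrak{A}_a$, and for each $j$ let $x_j^{\#_a}$, $y_j^{\#_a}$ be $a$-adjoints of $x_j$, $y_j$. Let $\mu\ge 0$ be real and let $(p_1,\dots,p_k)$ be a probability distribution, i.e. $p_j\ge 0$ for all $j$ and $\sum_{j=1}^k p_j=1$. Then \begin{align*} v_a^4\Big(\sum_{j=1}^k p_jx_j^{\#_a}y_j\Big)\le{}& \frac{1}{2(1+\mu)}v_a^2\Big(\sum_{j=1}^k p_jy_j^{\#_a}y_jx_j^{\#_a}x_j\Big)+\frac{1+2\mu}{8(1+\mu)}\Big(\sum_{j=1}^k p_j\big\|(x_j^{\#_a}x_j)^2+(y_j^{\#_a}y_j)^2\big\|_a\Big)^2\\ &-\frac18 c_a^2\Big(\sum_{j=1}^k p_j\big((x_j^{\#_a}x_j)^2-(y_j^{\#_a}y_j)^2\big)\Big). \end{align*}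
   Context: A linear functional $\varphi\in\mathfrak{A}^*$ is positive ($\varphi\ge0$) if $\varphi(x^*x)\ge 0$ for all $x\in\mathfrak{A}$. Set $\mathcal{S}_a(\mathfrak{A})=\{\varphi\in\mathfrak{A}^*:\varphi\ge 0,\ \varphi(a)=1\}$. For $x\in\mathfrak{A}$: the $a$-numerical range is $V_a(x)=\{\varphi(ax):\varphi\in\mathcal{S}_a(\mathfrak{A})\}$; the $a$-numerical radius is $v_a(x)=\sup\{|z|:z\in V_a(x)\}$; the $a$-Crawford number is $c_a(x)=\inf\{|z|:z\in V_a(x)\}$; and $\|x\|_a=\sup\{\sqrt{\varphi(x^*ax)}:\varphi\in\mathcal{S}_a(\mathfrak{A})\}$. An element $x^{\#_a}\in\mathfrak{A}$ is called an $a$-adjoint of $x\in\mathfrak{A}$ if $x^*a=ax^{\#_a}$ (it need not exist or be unique); $\mathfrak{A}_a$ is the set of all $x\in\mathfrak{A}$ that have an $a$-adjoint. Powers such as $v_a^4(x)$ and $c_a^2(x)$ mean $(v_a(x))^4$ and $(c_a(x))^2$. *)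

theory Defs
  imports "HOL-Analysis.Analysis"
begin

text \<open>
  Complex unital C*-algebras. The superclasses provide a real unital Banach algebra with
  submultiplicative norm and \<open>norm 1 = 1\<close>; in particular \<open>1 \<noteq> 0\<close>, which excludes only the zero
  algebra. The complex scalar multiplication \<open>scaleC\<close> extends the real one.
\<close>

class unital_cstar_algebra = real_normed_algebra_1 + banach +
  fixes scaleC :: "complex \<Rightarrow> 'a \<Rightarrow> 'a"
    and star :: "'a \<Rightarrow> 'a"
  assumes scaleC_add_right: "scaleC c (x + y) = scaleC c x + scaleC c y"
    and scaleC_add_left: "scaleC (c + d) x = scaleC c x + scaleC d x"
    and scaleC_scaleC: "scaleC c (scaleC d x) = scaleC (c * d) x"
    and scaleC_of_real: "scaleC (complex_of_real r) x = scaleR r x"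
    and scaleC_mult_left: "scaleC c x * y = scaleC c (x * y)"
    and scaleC_mult_right: "x * scaleC c y = scaleC c (x * y)"
    and norm_scaleC: "norm (scaleC c x) = cmod c * norm x"
    and star_star: "star (star x) = x"
    and star_add: "star (x + y) = star x + star y"
    and star_scaleC: "star (scaleC c x) = scaleC (cnj c) (star x)"
    and star_mult: "star (x * y) = star y * star x"
    and cstar_identity: "norm (star x * x) = (norm x)\<^sup>2"

definition cstar_spectrum :: "'a::unital_cstar_algebra \<Rightarrow> complex set" where
  "cstar_spectrum x =
     {z. \<not> (\<exists>y. (scaleC z 1 - x) * y = 1 \<and> y * (scaleC z 1 - x) = 1)}"

definition positive_element :: "'a::unital_cstar_algebra \<Rightarrow> bool" where
  "positive_element x \<longleftrightarrow> star x = x \<and> cstar_spectrum x \<subseteq> \<real>\<^sub>\<ge>\<^sub>0"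

text \<open>The topological dual: bounded complex-linear functionals.\<close>

definition cstar_dual :: "('a::unital_cstar_algebra \<Rightarrow> complex) set" where
  "cstar_dual = {\<phi>. bounded_linear \<phi> \<and> (\<forall>c x. \<phi> (scaleC c x) = c * \<phi> x)}"

definition positive_functional :: "('a::unital_cstar_algebra \<Rightarrow> complex) \<Rightarrow> bool" where
  "positive_functional \<phi> \<longleftrightarrow> \<phi> \<in> cstar_dual \<and> (\<forall>x. \<phi> (star x * x) \<in> \<real>\<^sub>\<ge>\<^sub>0)"

definition a_states :: "'a::unital_cstar_algebra \<Rightarrow> ('a \<Rightarrow> complex) set" where
  "a_states a = {\<phi>. positive_functional \<phi> \<and> \<phi> a = 1}"

definition a_numerical_range :: "'a::unital_cstar_algebra \<Rightarrow> 'a \<Rightarrow> complex set" where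
  "a_numerical_range a x = {\<phi> (a * x) | \<phi>. \<phi> \<in> a_states a}"

text \<open>
  The suprema and the infimum below are taken in the reals. For a non-zero positive \<open>a\<close> the set
  \<open>a_states a\<close> is non-empty, and the two suprema are finite at every \<open>x\<close> that has an \<open>a\<close>-adjoint.
  For other \<open>x\<close> they may be infinite mathematically; the real \<open>Sup\<close> is then unspecified.
\<close>

definition a_numerical_radius :: "'a::unital_cstar_algebra \<Rightarrow> 'a \<Rightarrow> real" where
  "a_numerical_radius a x = Sup {cmod z | z. z \<in> a_numerical_range a x}"

definition a_crawford_number :: "'a::unital_cstar_algebra \<Rightarrow> 'a \<Rightarrow> real" where
  "a_crawford_number a x = Inf {cmod z | z. z \<in> a_numerical_range a x}"

text \<open>For positive \<open>a\<close> and positive \<open>\<phi>\<close> the value \<open>\<phi> (star x * a * x)\<close> is real and non-negative,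
  so \<open>Re\<close> only adjusts the type.\<close>

definition a_seminorm :: "'a::unital_cstar_algebra \<Rightarrow> 'a \<Rightarrow> real" where
  "a_seminorm a x = Sup {sqrt (Re (\<phi> (star x * a * x))) | \<phi>. \<phi> \<in> a_states a}"

definition is_a_adjoint :: "'a::unital_cstar_algebra \<Rightarrow> 'a \<Rightarrow> 'a \<Rightarrow> bool" where
  "is_a_adjoint a x x' \<longleftrightarrow> star x * a = a * x'"

definition a_adjointable :: "'a::unital_cstar_algebra \<Rightarrow> 'a set" where
  "a_adjointable a = {x. \<exists>x'. is_a_adjoint a x x'}"

end

theory Submission
  imports Defs
begin

text \<open>
  For an \<open>a\<close>-state \<open>\<phi>\<close> the form \<open>\<langle>u, v\<rangle> = \<phi> (star u * a * v)\<close> is a positive semi-inner product with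
  \<open>\<langle>1, 1\<rangle> = 1\<close>. With \<open>X = x' * x\<close> and \<open>Y = y' * y\<close>, Cauchy--Schwarz bounds \<open>\<bar>\<Sum>p \<langle>x, y\<rangle>\<bar>\<^sup>2\<close> by
  \<open>L = \<Sum>p \<langle>Y, 1\<rangle> \<langle>1, X\<rangle>\<close>, and Buzano's inequality, summed before taking absolute values, gives
  \<open>L \<le> (W + N) / 2\<close> for \<open>W = \<bar>\<Sum>p \<langle>Y, X\<rangle>\<bar>\<close> and \<open>N = \<Sum>p \<parallel>X\<parallel> \<parallel>Y\<parallel> \<ge> W\<close>. Cauchy--Schwarz again bounds
  \<open>N\<^sup>2\<close> by \<open>(\<Sum>p \<parallel>X\<parallel>\<^sup>2) (\<Sum>p \<parallel>Y\<parallel>\<^sup>2) = (S\<^sup>2 - D\<^sup>2) / 4\<close>, where \<open>S\<close> and \<open>D\<close> average the sum and the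
  difference of \<open>\<parallel>X\<parallel>\<^sup>2\<close> and \<open>\<parallel>Y\<parallel>\<^sup>2\<close>; the parameter \<open>\<mu>\<close> interpolates between
  \<open>L\<^sup>2 \<le> (W\<^sup>2 + N\<^sup>2) / 2\<close> and \<open>L\<^sup>2 \<le> N\<^sup>2\<close>.

  The supremum over states means something only if \<open>a\<close>-states exist, which comes from Hahn--Banach
  and Kaplansky's theorem that \<open>star x * x\<close> is positive.
\<close>

section \<open>Unital C*-algebras and the binomial series\<close>

lemma scaleC_zero_right [simp]: "scaleC c (0::'a::unital_cstar_algebra) = 0"
  using scaleC_add_right[of c 0 0] by simp

lemma scaleC_minus_right: "scaleC c (- x) = - scaleC c (x::'a::unital_cstar_algebra)"
  using scaleC_add_right[of c x "- x"] by (simp add: add_eq_0_iff)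

lemma scaleC_diff_right: "scaleC c (x - y) = scaleC c x - scaleC c (y::'a::unital_cstar_algebra)"
  using scaleC_add_right[of c x "- y"] by (simp add: scaleC_minus_right)

lemma scaleC_one [simp]: "scaleC 1 x = (x::'a::unital_cstar_algebra)"
  using scaleC_of_real[of 1 x] by simp

lemma scaleC_uminus_left: "scaleC (- c) x = - scaleC c (x::'a::unital_cstar_algebra)"
proof -
  have "scaleC (c + (- c)) x = 0"
    using scaleC_of_real[of 0 x] by simp
  then show ?thesis
    unfolding scaleC_add_left by (simp add: add_eq_0_iff)
qed

lemma scaleC_scaleR: "scaleC c (r *\<^sub>R x) = r *\<^sub>R scaleC c (x::'a::unital_cstar_algebra)"
  by (simp add: scaleC_of_real[symmetric] scaleC_scaleC mult.commute)

lemma star_zero [simp]: "star (0::'a::unital_cstar_algebra) = 0"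
  using star_add[of 0 "0::'a"] by simp

lemma star_minus [simp]: "star (- x) = - star (x::'a::unital_cstar_algebra)"
  using star_add[of x "- x"] by (simp add: add_eq_0_iff)

lemma star_diff [simp]: "star (x - y) = star x - star (y::'a::unital_cstar_algebra)"
  using star_add[of x "- y"] by simp

lemma star_scaleR [simp]: "star (r *\<^sub>R x) = r *\<^sub>R star (x::'a::unital_cstar_algebra)"
  using star_scaleC[of "complex_of_real r" x] by (simp add: scaleC_of_real)

lemma star_one [simp]: "star (1::'a::unital_cstar_algebra) = 1"
  using star_mult[of "star (1::'a)" 1] by (simp add: star_star)

lemma star_of_real [simp]: "star (of_real r) = (of_real r::'a::unital_cstar_algebra)"
  by (simp add: of_real_def)

lemma star_sum: "star (\<Sum>j\<in>J. f j) = (\<Sum>j\<in>J. star (f j::'a::unital_cstar_algebra))"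
  by (induction J rule: infinite_finite_induct) (auto simp: star_add)

lemma star_power: "star (x ^ n) = star (x::'a::unital_cstar_algebra) ^ n"
  by (induction n) (auto simp: star_mult power_commutes)

text \<open>The C*-identity and submultiplicativity give \<open>norm y \<le> norm (star y)\<close>;
  using this for \<open>x\<close> and for \<open>star x\<close> yields both inequalities.\<close>

lemma norm_star [simp]: "norm (star x) = norm (x::'a::unital_cstar_algebra)"
proof -
  have le: "norm y \<le> norm (star y)" for y :: 'a
  proof (cases "y = 0")
    case False
    have "norm y * norm y \<le> norm (star y) * norm y"
      using norm_mult_ineq[of "star y" y] by (simp add: cstar_identity power2_eq_square)
    with False show ?thesis by simp
  qed simp
  show ?thesis using le[of x] le[of "star x"] by (simp add: star_star)
qed

lemma bounded_linear_star: "bounded_linear (star :: 'a::unital_cstar_algebra \<Rightarrow> 'a)"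
  by (rule bounded_linear_intro[where K = 1]) (auto simp: star_add)

lemma norm_square_self_adjoint:
  fixes h :: "'a::unital_cstar_algebra"
  assumes "star h = h"
  shows "norm (h * h) = (norm h)\<^sup>2"
  using cstar_identity[of h] assms by simp

lemma of_real_commutes: "of_real r * x = x * (of_real r :: 'a::real_algebra_1)"
  by (simp add: of_real_def)

section \<open>Two-sided inverses\<close>

definition has_inverse :: "'a::monoid_mult \<Rightarrow> bool" where
  "has_inverse x \<longleftrightarrow> (\<exists>y. x * y = 1 \<and> y * x = 1)"

lemma has_inverseE:
  assumes "has_inverse x"
  obtains y where "x * y = 1" "y * x = 1"
  using assms unfolding has_inverse_def by blast

lemma has_inverseI: "x * y = 1 \<Longrightarrow> z * x = 1 \<Longrightarrow> has_inverse x"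
  unfolding has_inverse_def by (metis mult.assoc mult.left_neutral mult.right_neutral)

lemma has_inverse_mult:
  assumes "has_inverse x" "has_inverse y"
  shows "has_inverse (x * y)"
proof -
  obtain u where u: "x * u = 1" "u * x = 1" using assms(1) by (rule has_inverseE)
  obtain v where v: "y * v = 1" "v * y = 1" using assms(2) by (rule has_inverseE)
  have "(x * y) * (v * u) = 1" using u v by (metis mult.assoc mult.left_neutral)
  moreover have "(v * u) * (x * y) = 1" using u v by (metis mult.assoc mult.left_neutral)
  ultimately show ?thesis unfolding has_inverse_def by blast
qed

lemma has_inverse_commuting_factor:
  assumes "has_inverse (x * y)" "x * y = y * x"
  shows "has_inverse x"
proof -
  obtain u where u: "(x * y) * u = 1" "u * (x * y) = 1" using assms(1) by (rule has_inverseE)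
  show ?thesis
  proof (rule has_inverseI)
    show "x * (y * u) = 1" using u(1) by (simp add: mult.assoc)
    show "(u * y) * x = 1" using u(2) assms(2) by (simp add: mult.assoc)
  qed
qed

lemma commutes_with_inverse:
  fixes x y z :: "'a::monoid_mult"
  assumes "x * y = 1" "y * x = 1" "z * x = x * z"
  shows "z * y = y * z"
  by (metis assms mult.assoc mult.left_neutral mult.right_neutral)

section \<open>The binomial series of (1 - h)^r\<close>

definition binomial_series :: "real \<Rightarrow> 'a::{real_normed_algebra_1,banach} \<Rightarrow> 'a" where
  "binomial_series r h = (\<Sum>n. (r gchoose n) *\<^sub>R (- h) ^ n)"

lemma gbinomial_Suc_mult_eq: "(r::real) gchoose Suc n = (r gchoose n) * ((r - real n) / (real n + 1))"
  by (simp add: gbinomial_prod_rev field_simps)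

text \<open>Successive coefficients have a ratio of modulus |r - n| / (n + 1), at most 1; so a
  geometric series dominates the binomial series.\<close>

lemma abs_gbinomial_le_1:
  fixes r :: real
  assumes "\<bar>r\<bar> \<le> 1"
  shows "\<bar>r gchoose n\<bar> \<le> 1"
proof (induction n)
  case (Suc n)
  have "\<bar>r gchoose Suc n\<bar> = \<bar>r gchoose n\<bar> * (\<bar>r - real n\<bar> / (real n + 1))"
    unfolding gbinomial_Suc_mult_eq by (simp add: abs_mult)
  also have "\<dots> \<le> 1 * 1"
    by (intro mult_mono Suc.IH) (use assms in \<open>auto simp: field_simps\<close>)
  finally show ?case by simp
qed simp

lemma summable_norm_binomial_series:
  fixes h :: "'a::{real_normed_algebra_1,banach}"
  assumes "\<bar>r\<bar> \<le> 1" "norm h < 1"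
  shows "summable (\<lambda>n. norm ((r gchoose n) *\<^sub>R (- h) ^ n))"
proof (rule summable_comparison_test')
  show "summable (\<lambda>n. norm h ^ n)" using assms by (simp add: summable_geometric)
  show "norm (norm ((r gchoose n) *\<^sub>R (- h) ^ n)) \<le> norm h ^ n" for n
  proof -
    have "norm ((r gchoose n) *\<^sub>R (- h) ^ n) \<le> 1 * norm h ^ n"
      unfolding norm_scaleR real_norm_def
      by (intro mult_mono abs_gbinomial_le_1 assms)
        (use norm_power_ineq[of "- h" n] in auto)
    then show ?thesis by simp
  qed
qed

lemma summable_binomial_series:
  fixes h :: "'a::{real_normed_algebra_1,banach}"
  assumes "\<bar>r\<bar> \<le> 1" "norm h < 1"
  shows "summable (\<lambda>n. (r gchoose n) *\<^sub>R (- h) ^ n)"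
  using summable_norm_binomial_series[OF assms] by (rule summable_norm_cancel)

text \<open>The exponent law: a Cauchy product of absolutely convergent series, with coefficients
  collected by Vandermonde's identity.\<close>

lemma binomial_series_mult:
  fixes h :: "'a::{real_normed_algebra_1,banach}"
  assumes "\<bar>r\<bar> \<le> 1" "\<bar>s\<bar> \<le> 1" "norm h < 1"
  shows "binomial_series r h * binomial_series s h = binomial_series (r + s) h"
proof -
  have "(\<Sum>i\<le>k. ((r gchoose i) *\<^sub>R (- h) ^ i) * ((s gchoose (k - i)) *\<^sub>R (- h) ^ (k - i)))
      = ((r + s) gchoose k) *\<^sub>R (- h) ^ k" for k
  proof -
    have "(\<Sum>i\<le>k. ((r gchoose i) *\<^sub>R (- h) ^ i) * ((s gchoose (k - i)) *\<^sub>R (- h) ^ (k - i)))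
        = (\<Sum>i\<le>k. ((r gchoose i) * (s gchoose (k - i))) *\<^sub>R (- h) ^ k)"
      by (intro sum.cong refl) (simp add: power_add[symmetric] mult.commute)
    also have "\<dots> = (\<Sum>i\<le>k. (r gchoose i) * (s gchoose (k - i))) *\<^sub>R (- h) ^ k"
      by (simp add: scaleR_left.sum)
    also have "(\<Sum>i\<le>k. (r gchoose i) * (s gchoose (k - i))) = (r + s) gchoose k"
      using gbinomial_Vandermonde[of r s k] by (simp add: atLeast0AtMost)
    finally show ?thesis .
  qed
  then show ?thesis
    unfolding binomial_series_def
    using Cauchy_product[OF summable_norm_binomial_series[OF assms(1,3)]
        summable_norm_binomial_series[OF assms(2,3)]] by simp
qed

lemma binomial_series_0 [simp]: "binomial_series 0 h = (1::'a::{real_normed_algebra_1,banach})"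
proof -
  have "(\<lambda>n. ((0::real) gchoose n) *\<^sub>R (- h) ^ n) sums (\<Sum>n\<in>{0}. ((0::real) gchoose n) *\<^sub>R (- h) ^ n)"
    by (rule sums_finite) (auto simp: gbinomial_0_left)
  then show ?thesis unfolding binomial_series_def by (simp add: sums_iff)
qed

lemma binomial_series_1 [simp]: "binomial_series 1 h = 1 - (h::'a::{real_normed_algebra_1,banach})"
proof -
  have "(\<lambda>n. ((1::real) gchoose n) *\<^sub>R (- h) ^ n) sums (\<Sum>n\<in>{0,1}. ((1::real) gchoose n) *\<^sub>R (- h) ^ n)"
  proof (rule sums_finite)
    fix n :: nat assume "n \<notin> {0, 1}"
    then have "(1::nat) choose n = 0" by (intro binomial_eq_0) auto
    then have "(1::real) gchoose n = 0"
      using binomial_gbinomial[of 1 n, where 'a = real] by (metis of_nat_0 of_nat_1)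
    then show "((1::real) gchoose n) *\<^sub>R (- h) ^ n = 0" by simp
  qed auto
  then show ?thesis unfolding binomial_series_def by (simp add: sums_iff)
qed

lemma binomial_series_commutes:
  fixes h z :: "'a::{real_normed_algebra_1,banach}"
  assumes "\<bar>r\<bar> \<le> 1" "norm h < 1" "z * h = h * z"
  shows "z * binomial_series r h = binomial_series r h * z"
proof -
  have "z * (- h) ^ n = (- h) ^ n * z" for n
    using power_commuting_commutes[of "- h" z n] assms(3) by simp
  then show ?thesis
    unfolding binomial_series_def
    using summable_binomial_series[OF assms(1,2)]
    by (simp add: suminf_mult[symmetric] suminf_mult2)
qed

lemma star_binomial_series:
  fixes h :: "'a::unital_cstar_algebra"
  assumes "\<bar>r\<bar> \<le> 1" "norm h < 1" "star h = h"
  shows "star (binomial_series r h) = binomial_series r h"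
  unfolding binomial_series_def
  using bounded_linear.suminf[OF bounded_linear_star summable_binomial_series[OF assms(1,2)]] assms(3)
  by (simp add: star_power)

lemma binomial_series_quarter_power4:
  fixes h :: "'a::{real_normed_algebra_1,banach}"
  assumes "norm h < 1"
  shows "binomial_series (1/4) h ^ 4 = 1 - h"
    and "(1 - h) * binomial_series (-1/4) h ^ 4 = 1"
proof -
  let ?B = "\<lambda>r. binomial_series r h"
  have "?B (1/4) ^ 4 = (?B (1/4) * ?B (1/4)) * (?B (1/4) * ?B (1/4))"
    by (simp add: numeral_eq_Suc mult.assoc)
  also have "\<dots> = ?B 1"
    using assms by (simp add: binomial_series_mult)
  finally show "?B (1/4) ^ 4 = 1 - h" by simp
  have "?B (-1/4) ^ 4 = (?B (-1/4) * ?B (-1/4)) * (?B (-1/4) * ?B (-1/4))"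
    by (simp add: numeral_eq_Suc mult.assoc)
  also have "\<dots> = ?B (- 1)"
    using assms by (simp add: binomial_series_mult)
  finally have *: "?B (-1/4) ^ 4 = ?B (- 1)" .
  have "?B 1 * ?B (- 1) = 1"
    using assms by (subst binomial_series_mult) auto
  with * show "(1 - h) * ?B (-1/4) ^ 4 = 1" by simp
qed

text \<open>The exponent -1 gives the Neumann series.\<close>

lemma has_inverse_one_minus:
  fixes h :: "'a::{real_normed_algebra_1,banach}"
  assumes "norm h < 1"
  shows "has_inverse (1 - h)"
proof (rule has_inverseI)
  show "(1 - h) * binomial_series (- 1) h = 1"
    using assms binomial_series_mult[of 1 "- 1" h] by simp
  show "binomial_series (- 1) h * (1 - h) = 1"
    using assms binomial_series_mult[of "- 1" 1 h] by simp
qed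

lemma has_inverse_of_real: "r \<noteq> 0 \<Longrightarrow> has_inverse (of_real r :: 'a::real_normed_algebra_1)"
  unfolding has_inverse_def
  by (rule exI[of _ "of_real (inverse r)"]) (simp flip: of_real_mult)

lemma has_inverse_of_real_add:
  fixes h :: "'a::{real_normed_algebra_1,banach}"
  assumes "norm h < t"
  shows "has_inverse (h + of_real t)"
proof -
  have t: "t > 0" using assms norm_ge_zero[of h] by linarith
  have "norm (- ((1/t) *\<^sub>R h)) < 1" using assms t by simp
  then have "has_inverse (of_real t * (1 - - ((1/t) *\<^sub>R h)))"
    using t by (intro has_inverse_mult has_inverse_of_real has_inverse_one_minus) auto
  also have "of_real t * (1 - - ((1/t) *\<^sub>R h)) = h + of_real t"
    using t by (simp add: distrib_left of_real_def)
  finally show ?thesis .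
qed

section \<open>Positive elements\<close>

lemma power_mult_commuting:
  fixes x y :: "'a::monoid_mult"
  assumes "x * y = y * x"
  shows "(x * y) ^ n = x ^ n * y ^ n"
proof (induction n)
  case (Suc n)
  have "(x * y) ^ Suc n = x * (y * x ^ n) * y ^ n"
    by (simp add: Suc.IH mult.assoc)
  also have "y * x ^ n = x ^ n * y"
    using power_commuting_commutes[OF assms, of n] by simp
  finally show ?case by (simp add: mult.assoc)
qed simp

section \<open>Bicommutants and fourth roots\<close>

definition bicommutant :: "'a::monoid_mult \<Rightarrow> 'a set" where
  "bicommutant h = {d. \<forall>z. z * h = h * z \<longrightarrow> z * d = d * z}"

lemma bicommutantD: "d \<in> bicommutant h \<Longrightarrow> z * h = h * z \<Longrightarrow> z * d = d * z"
  unfolding bicommutant_def by blast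

text \<open>With \<open>z = h\<close> the definition makes \<open>d\<close> commute with
  \<open>h\<close>, hence with \<open>k\<close>. So the bicommutant is commutative and can stand in
  for the closed algebra generated by \<open>h\<close>.\<close>

lemma bicommutant_commute:
  assumes "d \<in> bicommutant h" "k \<in> bicommutant h"
  shows "d * k = k * d"
  by (metis assms bicommutantD)

lemma bicommutant_mult: "d \<in> bicommutant h \<Longrightarrow> k \<in> bicommutant h \<Longrightarrow> d * k \<in> bicommutant h"
  unfolding bicommutant_def by clarify (metis mult.assoc)

lemma bicommutant_binomial_series:
  fixes k :: "'a::{real_normed_algebra_1,banach}"
  assumes "\<bar>r\<bar> \<le> 1" "norm k < 1" "k \<in> bicommutant h"
  shows "binomial_series r k \<in> bicommutant h"
  unfolding bicommutant_def
  using binomial_series_commutes[OF assms(1,2)] bicommutantD[OF assms(3)] by auto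

text \<open>A fourth root is asked for so that \<open>d * d\<close> is a square root of
  \<open>g\<close> that is itself the square of a self-adjoint element, hence positive.\<close>

definition has_fourth_root :: "'a::unital_cstar_algebra \<Rightarrow> 'a \<Rightarrow> bool" where
  "has_fourth_root h g \<longleftrightarrow> (\<exists>d. star d = d \<and> d ^ 4 = g \<and> d \<in> bicommutant h)"

text \<open>The new root is the old one times \<open>binomial_series r k\<close>. Both lie in the
  bicommutant of \<open>h\<close> and so commute, which makes the product self-adjoint and splits
  its fourth power.\<close>

lemma has_fourth_root_times_binomial_series:
  fixes h g k :: "'a::unital_cstar_algebra"
  assumes "has_fourth_root h g" "\<bar>r\<bar> \<le> 1" "norm k < 1" "star k = k" "k \<in> bicommutant h"
  shows "has_fourth_root h (g * binomial_series r k ^ 4)"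
proof -
  obtain d where d: "star d = d" "d ^ 4 = g" "d \<in> bicommutant h"
    using assms(1) unfolding has_fourth_root_def by blast
  let ?B = "binomial_series r k"
  have B: "?B \<in> bicommutant h" "star ?B = ?B"
    using assms by (auto intro: bicommutant_binomial_series star_binomial_series)
  have comm: "d * ?B = ?B * d" using d(3) B(1) by (rule bicommutant_commute)
  show ?thesis
    unfolding has_fourth_root_def
  proof (intro exI conjI)
    show "star (d * ?B) = d * ?B" by (simp add: star_mult d(1) B(2) comm)
    show "(d * ?B) ^ 4 = g * ?B ^ 4" by (simp add: power_mult_commuting[OF comm] d(2))
    show "d * ?B \<in> bicommutant h" using d(3) B(1) by (rule bicommutant_mult)
  qed
qed

text \<open>Invertibility of every \<open>h + \<epsilon>\<close> says that no negative real lies in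
  the spectrum. As self-adjoint elements have real spectrum, this is positivity expressed by real
  shifts only.\<close>

definition psd :: "'a::unital_cstar_algebra \<Rightarrow> bool" where
  "psd h \<longleftrightarrow> star h = h \<and> (\<forall>\<epsilon>>0. has_inverse (h + of_real \<epsilon>))"

lemma psd_star: "psd h \<Longrightarrow> star h = h"
  unfolding psd_def by blast

text \<open>Solvability of \<open>d ^ 4 = h + t\<close> is locally constant in \<open>t > 0\<close>: near \<open>t\<^sub>0\<close> the
  quotient of \<open>h + t\<close> and \<open>h + t\<^sub>0\<close> is \<open>1 - k\<close> with \<open>norm k < 1\<close>. Since it is solvable for
  large \<open>t\<close>, connectedness of \<open>{0<..}\<close> makes any functional calculus unnecessary.\<close>

lemma psd_has_fourth_root:
  fixes h :: "'a::unital_cstar_algebra"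
  assumes h: "psd h" and \<epsilon>: "\<epsilon> > 0"
  shows "has_fourth_root h (h + of_real \<epsilon>)"
proof -
  define good where "good t = has_fourth_root h (h + of_real t)" for t :: real
  have loc: "\<exists>\<delta>>0. \<forall>t. \<bar>t - t0\<bar> < \<delta> \<longrightarrow> good t0 = good t" if t0: "t0 > 0" for t0
  proof -
    obtain R where R: "(h + of_real t0) * R = 1" "R * (h + of_real t0) = 1"
      using h t0 unfolding psd_def by (blast elim: has_inverseE)
    have "star R * (h + of_real t0) = 1"
      using arg_cong[OF R(1), of star] psd_star[OF h] by (simp add: star_mult star_add)
    then have sR: "star R = R"
      using R(1) by (metis mult.assoc mult.left_neutral mult.right_neutral)
    have bR: "R \<in> bicommutant h"
    proof -
      have "z * R = R * z" if "z * h = h * z" for z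
        by (rule commutes_with_inverse[OF R])
          (simp add: distrib_left distrib_right that of_real_commutes)
      then show ?thesis unfolding bicommutant_def by blast
    qed
    \<comment> \<open>The radius keeps \<open>norm ?k\<close> below 1, where \<open>?k\<close>
      solves \<open>(h + t0) * (1 - ?k) = h + t\<close>. Roots move from \<open>t0\<close> to
      \<open>t\<close> by the power 1/4 of \<open>1 - ?k\<close>, and back by the power
      -1/4.\<close>
    have "good t0 = good t" if t: "\<bar>t - t0\<bar> < 1 / (norm R + 1)" for t
    proof -
      let ?k = "(t0 - t) *\<^sub>R R"
      have "norm ?k \<le> 1 / (norm R + 1) * norm R"
        using t mult_right_mono[of "\<bar>t0 - t\<bar>" "1 / (norm R + 1)" "norm R"]
        by (simp add: abs_minus_commute)
      also have "\<dots> < 1" by (simp add: field_simps add_pos_nonneg)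
      finally have nk: "norm ?k < 1" .
      have sk: "star ?k = ?k" by (simp add: sR)
      have bk: "?k \<in> bicommutant h" using bR unfolding bicommutant_def by auto
      have eq: "(h + of_real t0) * (1 - ?k) = h + of_real t"
        using R by (simp add: right_diff_distrib) (simp add: of_real_def algebra_simps)
      have "good t" if "good t0"
        using has_fourth_root_times_binomial_series[OF _ _ nk sk bk, of "h + of_real t0" "1/4"] that
        unfolding good_def by (simp only: binomial_series_quarter_power4[OF nk] eq)
      moreover have "good t0" if "good t"
        using has_fourth_root_times_binomial_series[OF _ _ nk sk bk, of "h + of_real t" "-1/4"] that
        unfolding good_def
        by (simp only: eq[symmetric] mult.assoc binomial_series_quarter_power4[OF nk]) simp
      ultimately show ?thesis by blast
    qed
    then show ?thesis
      by (intro exI[of _ "1 / (norm R + 1)"]) (auto simp: add_nonneg_pos)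
  qed
  \<comment> \<open>Beyond \<open>norm h\<close> a root is explicit:
    \<open>h + T = T * (1 - ?k)\<close> with \<open>norm ?k < 1\<close>, so \<open>root 4 T\<close>
    times the series of exponent 1/4 works.\<close>
  define T where "T = norm h + 1"
  have T: "T > 0" unfolding T_def by (simp add: add_nonneg_pos)
  have "good T"
  proof -
    let ?k = "- ((1/T) *\<^sub>R h)"
    have nk: "norm ?k < 1" unfolding T_def by (simp add: add_nonneg_pos)
    have bk: "?k \<in> bicommutant h" unfolding bicommutant_def by simp
    have "has_fourth_root h (of_real T)"
      unfolding has_fourth_root_def
    proof (intro exI conjI)
      show "of_real (root 4 T) ^ 4 = (of_real T :: 'a)"
        using T by (simp flip: of_real_power)
      show "(of_real (root 4 T) :: 'a) \<in> bicommutant h"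
        unfolding bicommutant_def by (auto simp: of_real_commutes)
    qed simp
    then have "has_fourth_root h (of_real T * (1 - ?k))"
      using has_fourth_root_times_binomial_series[OF _ _ nk _ bk, of "of_real T" "1/4"]
      using psd_star[OF h] by (simp add: binomial_series_quarter_power4[OF nk])
    also have "of_real T * (1 - ?k) = h + of_real T"
      using T by (simp add: distrib_left) (simp add: of_real_def)
    finally show ?thesis unfolding good_def .
  qed
  moreover have "good T = good \<epsilon>"
  proof (rule connected_local_const[of "{0<..}"])
    show "\<forall>a\<in>{0<..}. \<forall>\<^sub>F b in at a within {0<..}. good a = good b"
    proof
      fix a :: real assume "a \<in> {0<..}"
      then obtain \<delta> where "\<delta> > 0" "\<forall>t. \<bar>t - a\<bar> < \<delta> \<longrightarrow> good a = good t"
        using loc by auto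
      then show "\<forall>\<^sub>F b in at a within {0<..}. good a = good b"
        unfolding eventually_at dist_real_def by blast
    qed
  qed (use T \<epsilon> in auto)
  ultimately show ?thesis unfolding good_def by simp
qed

lemma psd_fourth_root:
  fixes h :: "'a::unital_cstar_algebra"
  assumes "psd h" "\<epsilon> > 0"
  obtains d where "star d = d" "(d * d) * (d * d) = h + of_real \<epsilon>"
    "\<And>z. z * h = h * z \<Longrightarrow> z * d = d * z"
proof -
  obtain d where d: "star d = d" "d ^ 4 = h + of_real \<epsilon>" "d \<in> bicommutant h"
    using psd_has_fourth_root[OF assms] unfolding has_fourth_root_def by blast
  show thesis
  proof (rule that)
    show "(d * d) * (d * d) = h + of_real \<epsilon>"
      using d(2) by (simp add: power4_eq_xxxx mult.assoc)
  qed (use d(1) bicommutantD[OF d(3)] in blast)+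
qed

section \<open>Imaginary shifts and squares of self-adjoint elements\<close>

lemma has_inverse_add_scaleC:
  fixes z :: "'a::unital_cstar_algebra"
  assumes "norm z < cmod c"
  shows "has_inverse (z + scaleC c 1)"
proof -
  have c: "c \<noteq> 0" using assms by auto
  have "norm (- scaleC (1/c) z) < 1"
    using assms c by (simp add: norm_scaleC norm_divide)
  then have "has_inverse (1 - - scaleC (1/c) z)"
    by (rule has_inverse_one_minus)
  moreover have "has_inverse (scaleC c (1::'a))"
    by (rule has_inverseI[of _ "scaleC (1/c) 1" "scaleC (1/c) 1"])
      (use c in \<open>simp_all add: scaleC_mult_left scaleC_scaleC\<close>)
  ultimately have "has_inverse (scaleC c 1 * (1 - - scaleC (1/c) z))"
    by (rule has_inverse_mult[rotated])
  also have "scaleC c 1 * (1 - - scaleC (1/c) z) = z + scaleC c 1"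
    using c by (simp add: distrib_left scaleC_mult_left scaleC_scaleC)
  finally show ?thesis .
qed

lemma self_adjoint_times_conjugate:
  fixes d :: "'a::unital_cstar_algebra"
  shows "(d + scaleC (\<i> * of_real s) 1) * (d - scaleC (\<i> * of_real s) 1) = d * d + of_real (s * s)"
proof -
  have "\<i> * complex_of_real s * (\<i> * of_real s) = of_real (- (s * s))"
    by (simp add: algebra_simps) 
  then have "scaleC (\<i> * of_real s * (\<i> * of_real s)) (1::'a) = - of_real (s * s)"
    by (simp only: scaleC_of_real) (simp add: of_real_def)
  then show ?thesis
    by (simp add: distrib_right right_diff_distrib scaleC_mult_left scaleC_mult_right
        scaleC_scaleC scaleC_add_right del: of_real_mult)
qed

text \<open>Arens' trick: shifting \<open>d + i \<eta>\<close> far along the imaginary axis turns the C*-identity into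
  a Neumann series estimate.\<close>

lemma self_adjoint_imaginary_shift_has_inverse:
  fixes d :: "'a::unital_cstar_algebra"
  assumes d: "star d = d" and \<eta>: "\<eta> \<noteq> 0"
  shows "has_inverse (d + scaleC (\<i> * of_real \<eta>) 1)"
proof -
  \<comment> \<open>Both squares to be compared contain \<open>s\<^sup>2\<close>; this choice makes
    the cross term \<open>2 * \<eta> * s\<close> equal to \<open>(norm d)\<^sup>2\<close>, leaving
    the surplus \<open>\<eta>\<^sup>2 > 0\<close>.\<close>
  define s where "s = (norm d)\<^sup>2 / (2 * \<eta>)"
  let ?z = "d - scaleC (\<i> * of_real s) 1"
  have "star ?z = d + scaleC (\<i> * of_real s) 1"
    by (simp add: d star_scaleC scaleC_uminus_left)
  then have "(norm ?z)\<^sup>2 = norm (d * d + of_real (s * s))"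
    by (metis cstar_identity self_adjoint_times_conjugate)
  also have "\<dots> \<le> (norm d)\<^sup>2 + s\<^sup>2"
    using norm_triangle_ineq[of "d * d" "of_real (s * s)"]
    by (simp add: norm_square_self_adjoint[OF d] power2_eq_square norm_mult del: of_real_mult)
  also have "\<dots> < (\<eta> + s)\<^sup>2"
    using \<eta> by (simp add: power2_sum s_def)
  finally have "norm ?z < \<bar>\<eta> + s\<bar>"
    by (metis abs_ge_zero power2_abs power_less_imp_less_base)
  also have "\<bar>\<eta> + s\<bar> = cmod (\<i> * of_real (\<eta> + s))"
    by (simp only: norm_mult norm_ii norm_of_real) simp
  finally have "has_inverse (?z + scaleC (\<i> * of_real (\<eta> + s)) 1)"
    by (rule has_inverse_add_scaleC)
  also have "?z + scaleC (\<i> * of_real (\<eta> + s)) 1 = d + scaleC (\<i> * of_real \<eta>) 1"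
    by (simp add: distrib_left scaleC_add_left)
  finally show ?thesis .
qed

text \<open>\<open>d * d + \<epsilon>\<close> factors as (d + i sqrt \<epsilon>)(d - i sqrt
  \<epsilon>), and both factors are invertible imaginary shifts.\<close>

lemma psd_square:
  fixes d :: "'a::unital_cstar_algebra"
  assumes d: "star d = d"
  shows "psd (d * d)"
  unfolding psd_def
proof (intro conjI allI impI)
  show "star (d * d) = d * d" by (simp add: star_mult d)
  fix \<epsilon> :: real assume \<epsilon>: "\<epsilon> > 0"
  have "has_inverse ((d + scaleC (\<i> * of_real (sqrt \<epsilon>)) 1) * (d + scaleC (\<i> * of_real (- sqrt \<epsilon>)) 1))"
    by (intro has_inverse_mult self_adjoint_imaginary_shift_has_inverse d) (use \<epsilon> in auto)
  also have "(d + scaleC (\<i> * of_real (sqrt \<epsilon>)) 1) * (d + scaleC (\<i> * of_real (- sqrt \<epsilon>)) 1)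
      = d * d + of_real \<epsilon>"
    using self_adjoint_times_conjugate[of d "sqrt \<epsilon>"] \<epsilon>
    by (simp add: scaleC_uminus_left del: of_real_mult)
  finally show "has_inverse (d * d + of_real \<epsilon>)" .
qed

section \<open>Positivity and the norm\<close>

text \<open>Up to scale, \<open>h\<close> is the real part of a unitary. With
  \<open>T = t + \<epsilon>\<close> and a self-adjoint square root \<open>g\<close> of
  \<open>T * T - h * h\<close> that commutes with \<open>h\<close>, the element
  \<open>w = h + i g\<close> satisfies \<open>star w * w = T * T\<close>; so
  \<open>norm w = T\<close>, and \<open>h\<close> is the real part of \<open>w\<close>.\<close>

lemma norm_le_if_psd:
  fixes h :: "'a::unital_cstar_algebra"
  assumes p: "psd (of_real t - h)" "psd (of_real t + h)" and t: "t \<ge> 0"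
  shows "norm h \<le> t"
proof (rule field_le_epsilon)
  fix \<epsilon> :: real assume \<epsilon>: "\<epsilon> > 0"
  obtain d where d: "star d = d" "(d * d) * (d * d) = of_real t - h + of_real \<epsilon>"
      "\<And>z. z * (of_real t - h) = (of_real t - h) * z \<Longrightarrow> z * d = d * z"
    by (rule psd_fourth_root[OF p(1) \<epsilon>]) blast
  obtain e where e: "star e = e" "(e * e) * (e * e) = of_real t + h + of_real \<epsilon>"
      "\<And>z. z * (of_real t + h) = (of_real t + h) * z \<Longrightarrow> z * e = e * z"
    by (rule psd_fourth_root[OF p(2) \<epsilon>]) blast
  have h: "star h = h" using psd_star[OF p(2)] by (simp add: star_add)
  define T where "T = t + \<epsilon>"
  have hd: "h * d = d * h"
    by (rule d(3)) (simp add: algebra_simps of_real_commutes)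
  have he: "h * e = e * h"
    by (rule e(3)) (simp add: algebra_simps of_real_commutes)
  have de: "d * e = e * d"
    by (rule e(3)) (simp add: algebra_simps of_real_commutes hd)
  \<comment> \<open>The square roots \<open>d * d\<close> and \<open>e * e\<close> of
    \<open>T - h\<close> and \<open>T + h\<close> commute, so their product is self-adjoint and
    squares to \<open>T * T - h * h\<close>.\<close>
  define g where "g = (d * d) * (e * e)"
  have sg: "star g = g"
    unfolding g_def using d(1) e(1) de by (simp add: star_mult) (metis mult.assoc)
  have hg: "h * g = g * h"
    unfolding g_def using hd he by (metis mult.assoc)
  have "g * g = ((d * d) * (d * d)) * ((e * e) * (e * e))"
  proof -
    have "(d * d) * (e * e) = (e * e) * (d * d)" using de by (metis mult.assoc)
    from power_mult_commuting[OF this, of 2] show ?thesis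
      unfolding g_def by (simp add: power2_eq_square)
  qed
  also have "\<dots> = (of_real T - h) * (of_real T + h)"
    unfolding d(2) e(2) T_def by (simp add: algebra_simps)
  also have "\<dots> = of_real (T * T) - h * h"
    by (simp add: algebra_simps of_real_commutes[of T h])
  finally have gg: "g * g = of_real (T * T) - h * h" .
  define w where "w = h + scaleC \<i> g"
  have sw: "star w = h - scaleC \<i> g"
    unfolding w_def by (simp add: star_add star_scaleC h sg scaleC_uminus_left)
  have "star w * w = h * h + g * g"
    unfolding sw unfolding w_def
    by (simp add: algebra_simps scaleC_mult_left scaleC_mult_right scaleC_scaleC hg
        scaleC_uminus_left scaleC_diff_right)
  then have "star w * w = of_real (T * T)" by (simp add: gg)
  then have "(norm w)\<^sup>2 = T\<^sup>2"
    by (metis cstar_identity norm_of_real abs_mult_self_eq abs_mult power2_eq_square)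
  then have nw: "norm w = T"
    using t \<epsilon> unfolding T_def by simp
  have "h = (1/2) *\<^sub>R (w + star w)"
    unfolding sw unfolding w_def by (simp add: scaleR_2[symmetric])
  then have "norm h \<le> (1/2) * (norm w + norm (star w))"
    by (metis norm_scaleR norm_triangle_ineq mult_left_mono abs_of_nonneg
        zero_le_divide_1_iff zero_le_numeral real_norm_def)
  then show "norm h \<le> t + \<epsilon>" by (simp add: nw T_def)
qed

lemma psd_of_real_minus:
  fixes h :: "'a::unital_cstar_algebra"
  assumes "star h = h" "norm h \<le> t"
  shows "psd (of_real t - h)"
  unfolding psd_def
proof (intro conjI allI impI)
  fix \<epsilon> :: real assume "\<epsilon> > 0"
  then have "has_inverse (- h + of_real (t + \<epsilon>))"
    using assms by (intro has_inverse_of_real_add) simp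
  then show "has_inverse (of_real t - h + of_real \<epsilon>)"
    by (simp add: algebra_simps)
qed (simp add: assms)

text \<open>Both \<open>t - (t - h) = h\<close> and \<open>t + (t - h) = 2 * t - h\<close> are
  positive if \<open>h\<close> is, so \<open>norm_le_if_psd\<close> applies to \<open>t - h\<close>.
  In this form, closure of positivity under addition is the triangle inequality.\<close>

lemma psd_iff_norm:
  fixes h :: "'a::unital_cstar_algebra"
  assumes "star h = h" "norm h \<le> t"
  shows "psd h \<longleftrightarrow> norm (of_real t - h) \<le> t"
proof
  have t: "t \<ge> 0" using assms(2) norm_ge_zero[of h] by linarith
  {
    assume "psd h"
    then have 1: "psd (of_real t - (of_real t - h))" by simp
    have "psd (of_real (t + t) - h)"
      using assms t by (intro psd_of_real_minus) auto
    also have "of_real (t + t) - h = of_real t + (of_real t - h)"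
      by (simp only: of_real_add add_diff_eq)
    finally show "norm (of_real t - h) \<le> t"
      using t by (intro norm_le_if_psd[OF 1])
  }
  assume "norm (of_real t - h) \<le> t"
  then have "psd (of_real t - (of_real t - h))"
    by (intro psd_of_real_minus) (simp add: assms)
  then show "psd h" by simp
qed

lemma psd_add:
  fixes h k :: "'a::unital_cstar_algebra"
  assumes "psd h" "psd k"
  shows "psd (h + k)"
proof -
  let ?s = "norm h" and ?t = "norm k"
  have sa: "star h = h" "star k = k" using assms psd_star by auto
  have "norm (of_real (?s + ?t) - (h + k)) = norm ((of_real ?s - h) + (of_real ?t - k))"
    by (simp add: algebra_simps)
  also have "\<dots> \<le> ?s + ?t"
    using assms psd_iff_norm[OF sa(1) order_refl] psd_iff_norm[OF sa(2) order_refl]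
    by (intro norm_triangle_le add_mono) auto
  finally show ?thesis
    using psd_iff_norm[of "h + k" "?s + ?t"] by (metis norm_triangle_ineq sa star_add)
qed

lemma psd_of_real: "r \<ge> 0 \<Longrightarrow> psd (of_real r :: 'a::unital_cstar_algebra)"
  using psd_of_real_minus[of 0 r] by simp

lemma psd_scaleR:
  assumes "psd (h::'a::unital_cstar_algebra)" "r \<ge> 0"
  shows "psd (r *\<^sub>R h)"
proof (cases "r = 0")
  case True
  then show ?thesis using psd_of_real[of 0] by simp
next
  case False
  with assms have r: "r > 0" by simp
  show ?thesis
    unfolding psd_def
  proof (intro conjI allI impI)
    show "star (r *\<^sub>R h) = r *\<^sub>R h" using psd_star[OF assms(1)] by simp
    fix \<epsilon> :: real assume \<epsilon>: "\<epsilon> > 0"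
    have "has_inverse (of_real r * (h + of_real (\<epsilon> / r)))"
      using r \<epsilon> assms(1) unfolding psd_def
      by (intro has_inverse_mult has_inverse_of_real) auto
    also have "of_real r * (h + of_real (\<epsilon> / r)) = r *\<^sub>R h + of_real \<epsilon>"
      using r by (simp add: distrib_left flip: of_real_mult) (simp add: scaleR_conv_of_real)
    finally show "has_inverse (r *\<^sub>R h + of_real \<epsilon>)" .
  qed
qed

lemma psd_if_shifts_psd:
  fixes h :: "'a::unital_cstar_algebra"
  assumes "\<And>\<epsilon>. \<epsilon> > 0 \<Longrightarrow> psd (h + of_real \<epsilon>)"
  shows "psd h"
  unfolding psd_def
proof (intro conjI allI impI)
  show "star h = h" using psd_star[OF assms[of 1]] by (simp add: star_add)
  fix \<epsilon> :: real assume \<epsilon>: "\<epsilon> > 0"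
  have "has_inverse (h + of_real (\<epsilon>/2) + of_real (\<epsilon>/2))"
    using assms[of "\<epsilon>/2"] \<epsilon> unfolding psd_def by simp
  also have "h + of_real (\<epsilon>/2) + of_real (\<epsilon>/2) = h + of_real \<epsilon>"
    by (simp only: add.assoc of_real_add[symmetric]) simp
  finally show "has_inverse (h + of_real \<epsilon>)" .
qed

section \<open>Kaplansky's theorem\<close>

text \<open>The products \<open>x * y\<close> and \<open>y * x\<close> have the same nonzero
  spectrum: if \<open>u\<close> inverts \<open>l - x * y\<close>, then
  \<open>(1 + y * u * x) / l\<close> inverts \<open>l - y * x\<close>.\<close>

lemma psd_of_real_minus_mult_swap:
  fixes x y :: "'a::unital_cstar_algebra"
  assumes "psd (of_real \<delta> - x * y)" "star (y * x) = y * x" "\<delta> \<ge> 0"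
  shows "psd (of_real \<delta> - y * x)"
  unfolding psd_def
proof (intro conjI allI impI)
  show "star (of_real \<delta> - y * x) = of_real \<delta> - y * x" using assms(2) by simp
  fix \<epsilon> :: real assume \<epsilon>: "\<epsilon> > 0"
  define l where "l = \<delta> + \<epsilon>"
  have l: "l \<noteq> 0" using assms(3) \<epsilon> unfolding l_def by simp
  have shift: "of_real \<delta> - z + of_real \<epsilon> = l *\<^sub>R 1 - z" for z :: 'a
    by (simp add: l_def of_real_def algebra_simps)
  have "has_inverse (l *\<^sub>R 1 - x * y)"
    using assms(1) \<epsilon> shift[of "x * y"] unfolding psd_def by metis
  then obtain u where u: "(l *\<^sub>R 1 - x * y) * u = 1" "u * (l *\<^sub>R 1 - x * y) = 1"
    by (rule has_inverseE)
  have xyu: "x * y * u = l *\<^sub>R u - 1" and uxy: "u * (x * y) = l *\<^sub>R u - 1"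
    using u by (simp_all add: algebra_simps)
  have "(l *\<^sub>R 1 - y * x) * (1 + y * u * x) = l *\<^sub>R 1 - y * x + l *\<^sub>R (y * u * x) - y * (x * y * u) * x"
    by (simp add: algebra_simps)
  also have "\<dots> = l *\<^sub>R 1"
    unfolding xyu by (simp add: algebra_simps)
  finally have 1: "(l *\<^sub>R 1 - y * x) * ((1/l) *\<^sub>R (1 + y * u * x)) = 1"
    using l by simp
  have "(1 + y * u * x) * (l *\<^sub>R 1 - y * x) = l *\<^sub>R 1 - y * x + l *\<^sub>R (y * u * x) - y * (u * (x * y)) * x"
    by (simp add: algebra_simps)
  also have "\<dots> = l *\<^sub>R 1"
    unfolding uxy by (simp add: algebra_simps)
  finally have 2: "((1/l) *\<^sub>R (1 + y * u * x)) * (l *\<^sub>R 1 - y * x) = 1"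
    using l by simp
  show "has_inverse (of_real \<delta> - y * x + of_real \<epsilon>)"
    unfolding shift by (rule has_inverseI[OF 1 2])
qed

text \<open>\<open>P\<close> and \<open>Q\<close> are the real and imaginary parts of
  \<open>y\<close> up to real factors, and their squares add up to twice the element in
  question.\<close>

lemma psd_star_mult_add_mult_star:
  fixes y :: "'a::unital_cstar_algebra"
  shows "psd (star y * y + y * star y)"
proof -
  define P where "P = y + star y"
  define Q where "Q = scaleC \<i> (y - star y)"
  have "star P = P" unfolding P_def by (simp add: star_add star_star)
  moreover have "star Q = Q"
    unfolding Q_def
    by (simp add: star_scaleC star_star scaleC_uminus_left scaleC_diff_right)
  ultimately have "psd ((1/2) *\<^sub>R (P * P + Q * Q))"
    by (intro psd_scaleR psd_add psd_square) auto
  also have "P * P + Q * Q = 2 *\<^sub>R (star y * y + y * star y)"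
    unfolding P_def Q_def
    by (simp add: scaleC_mult_left scaleC_mult_right scaleC_scaleC scaleC_uminus_left
        scaleC_diff_right algebra_simps scaleR_2)
  finally show ?thesis by simp
qed

text \<open>Kaplansky's argument with \<open>v = sqrt (h\<^sup>2 + s\<^sup>2) - h\<close> as an approximation of twice the
  negative part of \<open>h = star x * x\<close>.\<close>

lemma psd_star_mult:
  fixes x :: "'a::unital_cstar_algebra"
  shows "psd (star x * x)"
proof (rule psd_if_shifts_psd)
  fix \<epsilon> :: real assume \<epsilon>: "\<epsilon> > 0"
  define h where "h = star x * x"
  have sh: "star h = h" unfolding h_def by (simp add: star_mult star_star)
  \<comment> \<open>The constants are tuned for the end, where \<open>(norm v)\<^sup>2\<close> is at
    most \<open>s + 2 * s * norm h + 2 * \<delta>\<close>: the first two terms add up to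
    \<open>2 * \<delta>\<close>, and \<open>4 * \<delta> = \<epsilon>\<^sup>2\<close>.\<close>
  define \<delta> where "\<delta> = \<epsilon>\<^sup>2 / 4"
  define s where "s = \<delta> / (1/2 + norm h)"
  have \<delta>: "\<delta> > 0" unfolding \<delta>_def using \<epsilon> by simp
  have den: "1/2 + norm h > 0" using norm_ge_zero[of h] by linarith
  have s: "s > 0" unfolding s_def using \<delta> den by simp
  have s\<delta>: "s / 2 + s * norm h = \<delta>" 
  proof -
    have "s / 2 + s * norm h = s * (1/2 + norm h)" by (simp add: algebra_simps)
    also have "\<dots> = \<delta>" unfolding s_def using den by simp
    finally show ?thesis .
  qed
  obtain d where d: "star d = d" "(d * d) * (d * d) = h * h + of_real s"
      "\<And>z. z * (h * h) = (h * h) * z \<Longrightarrow> z * d = d * z"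
    by (rule psd_fourth_root[OF psd_square[OF sh] s]) blast
  define e where "e = d * d"
  have e: "psd e" "e * e = h * h + of_real s"
    unfolding e_def using psd_square[OF d(1)] d(2) by auto
  have se: "star e = e" using psd_star[OF e(1)] .
  have "h * d = d * h" by (rule d(3)) (simp add: mult.assoc)
  then have he: "h * e = e * h" unfolding e_def by (metis mult.assoc)
  define v where "v = e - h"
  have sv: "star v = v" unfolding v_def by (simp add: se sh)
  have "psd v"
    unfolding psd_def
  proof (intro conjI allI impI)
    fix t :: real assume t: "t > 0"
    \<comment> \<open>Because \<open>e * e - h * h = s\<close>, the product is
      \<open>2 * t * e + s + t * t\<close>, a scalar multiple of an invertible shift of
      \<open>e\<close>; the commuting factor \<open>v + t\<close> inherits invertibility.\<close>
    have eq: "(v + of_real t) * (e + h + of_real t) = of_real (2 * t) * (e + of_real ((s + t * t) / (2 * t)))"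
    proof -
      have "(v + t *\<^sub>R 1) * (e + h + t *\<^sub>R 1) = (2 * t) *\<^sub>R e + (s + t * t) *\<^sub>R 1"
        unfolding v_def
        by (simp add: algebra_simps he e(2)) (simp add: of_real_def scaleR_2[symmetric] algebra_simps)
      also have "\<dots> = (2 * t) *\<^sub>R (e + ((s + t * t) / (2 * t)) *\<^sub>R 1)"
        using t by (simp add: scaleR_add_right)
      finally show ?thesis
        by (simp only: of_real_def mult_scaleR_left mult_1_left)
    qed
    have comm: "(v + of_real t) * (e + h + of_real t) = (e + h + of_real t) * (v + of_real t)"
      unfolding v_def of_real_def by (simp add: algebra_simps he)
    have "(s + t * t) / (2 * t) > 0"
      using s t by (simp add: add_pos_pos)
    then have "has_inverse (e + of_real ((s + t * t) / (2 * t)))"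
      using e(1) unfolding psd_def by blast
    then have "has_inverse (of_real (2 * t) * (e + of_real ((s + t * t) / (2 * t))))"
      using t by (intro has_inverse_mult has_inverse_of_real) simp_all
    then show "has_inverse (v + of_real t)"
      using has_inverse_commuting_factor[OF _ comm] by (simp only: eq)
  qed (rule sv)
  then obtain r where r: "star r = r" "(r * r) * (r * r) = v + of_real s"
      "\<And>z. z * v = v * z \<Longrightarrow> z * r = r * z"
    by (rule psd_fourth_root[OF _ s]) blast
  have hr: "h * r = r * h"
    by (rule r(3)) (simp add: v_def algebra_simps he)
  \<comment> \<open>As \<open>r * r\<close> is a square root of \<open>v + s\<close>, the element
    \<open>star y * y\<close> is \<open>(v + s) * h\<close>. This is nearly negative, since
    \<open>2 * v * h = s - v * v\<close>.\<close>
  define y where "y = x * (r * r)"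
  have "star y * y = (r * r) * h * (r * r)"
    unfolding y_def h_def by (simp add: star_mult r(1) mult.assoc)
  also have "\<dots> = ((r * r) * (r * r)) * h"
    using hr by (metis mult.assoc)
  also have "\<dots> = v * h + s *\<^sub>R h"
    unfolding r(2) by (simp add: distrib_right of_real_def)
  also have "v * h = (1/2) *\<^sub>R (of_real s - v * v)"
  proof -
    have "2 *\<^sub>R (v * h) = of_real s - v * v"
      unfolding v_def by (simp add: algebra_simps he e(2) scaleR_2)
    then show ?thesis by (metis scaleR_half_double scaleR_2)
  qed
  finally have yy: "star y * y = (1/2) *\<^sub>R (of_real s - v * v) + s *\<^sub>R h" .
  have "psd ((1/2) *\<^sub>R (v * v) + s *\<^sub>R (of_real (norm h) - h))"
    using s sv sh by (intro psd_add psd_scaleR psd_square psd_of_real_minus) auto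
  also have "(1/2) *\<^sub>R (v * v) + s *\<^sub>R (of_real (norm h) - h) = of_real \<delta> - star y * y"
    unfolding yy s\<delta>[symmetric] by (simp add: of_real_def algebra_simps)
  finally have le1: "psd (of_real \<delta> - star y * y)" .
  \<comment> \<open>From \<open>y * star y \<le> \<delta>\<close> and positivity of
    \<open>star y * y + y * star y\<close> it follows that
    \<open>star y * y \<ge> - \<delta>\<close>, so its norm is at most
    \<open>\<delta>\<close>.\<close>
  have "psd (of_real \<delta> - y * star y)"
    by (rule psd_of_real_minus_mult_swap[OF le1]) (use \<delta> in \<open>simp_all add: star_mult star_star\<close>)
  then have "psd ((star y * y + y * star y) + (of_real \<delta> - y * star y))"
    by (intro psd_add psd_star_mult_add_mult_star)
  then have "psd (of_real \<delta> + star y * y)"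
    by (simp add: algebra_simps)
  then have nyy: "norm (star y * y) \<le> \<delta>"
    using le1 \<delta> by (intro norm_le_if_psd) auto
  \<comment> \<open>Solving for \<open>v * v\<close> shows that \<open>v\<close> is small; then
    \<open>h + \<epsilon> = e + (\<epsilon> - v)\<close> is a sum of two positive elements.\<close>
  have "v * v = s *\<^sub>R 1 + (2 * s) *\<^sub>R h - 2 *\<^sub>R (star y * y)"
    unfolding yy by (simp add: of_real_def algebra_simps)
  then have "norm (v * v) \<le> norm (s *\<^sub>R (1::'a)) + norm ((2 * s) *\<^sub>R h) + norm (2 *\<^sub>R (star y * y))"
    by (simp only:) (intro order_trans[OF norm_triangle_ineq4] add_right_mono norm_triangle_ineq)
  also have "\<dots> \<le> s + (2 * s) * norm h + 2 * \<delta>"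
    using s nyy by simp
  also have "\<dots> = \<epsilon>\<^sup>2"
    using s\<delta> unfolding \<delta>_def by (simp add: field_simps)
  finally have "(norm v)\<^sup>2 \<le> \<epsilon>\<^sup>2"
    by (simp add: norm_square_self_adjoint[OF sv])
  then have "norm v \<le> \<epsilon>"
    by (rule power2_le_imp_le) (use \<epsilon> in simp)
  then have "psd (e + (of_real \<epsilon> - v))"
    using e(1) sv by (intro psd_add psd_of_real_minus)
  then show "psd (star x * x + of_real \<epsilon>)"
    unfolding v_def h_def by (simp add: algebra_simps)
qed

section \<open>Hahn--Banach for sublinear functionals\<close>

definition sublinear :: "('v::real_vector \<Rightarrow> real) \<Rightarrow> bool" where
  "sublinear q \<longleftrightarrow> (\<forall>x y. q (x + y) \<le> q x + q y) \<and> (\<forall>r\<ge>0. \<forall>x. q (r *\<^sub>R x) = r * q x)"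

lemma sublinearI:
  assumes "\<And>x y. q (x + y) \<le> q x + q y" "q 0 = 0" "\<And>r x. r > 0 \<Longrightarrow> q (r *\<^sub>R x) \<le> r * q x"
  shows "sublinear q"
  unfolding sublinear_def
proof (intro conjI allI impI assms(1))
  fix r :: real and x :: 'a assume r: "r \<ge> 0"
  show "q (r *\<^sub>R x) = r * q x"
  proof (cases "r = 0")
    case False
    with r have r: "r > 0" by simp
    have "q x \<le> (1/r) * q (r *\<^sub>R x)"
      using assms(3)[of "1/r" "r *\<^sub>R x"] r by simp
    then show ?thesis using assms(3)[OF r, of x] r by (simp add: field_simps)
  qed (simp add: assms(2))
qed

lemma sublinear_add: "sublinear q \<Longrightarrow> q (x + y) \<le> q x + q y"
  and sublinear_scaleR: "sublinear q \<Longrightarrow> r \<ge> 0 \<Longrightarrow> q (r *\<^sub>R x) = r * q x"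
  unfolding sublinear_def by auto

lemma sublinear_0: "sublinear q \<Longrightarrow> q 0 = 0"
  using sublinear_scaleR[of q 0 0] by simp

lemma sublinear_lower: "sublinear q \<Longrightarrow> - q (- x) \<le> q x"
  using sublinear_add[of q x "- x"] sublinear_0[of q] by simp

text \<open>For sublinear \<open>q\<close> this is the greatest sublinear minorant of
  \<open>q\<close> whose value at \<open>- y\<close> is at most \<open>- q y\<close>. Passing to it
  forces oddness at \<open>y\<close>.\<close>

definition tilt :: "('v::real_vector \<Rightarrow> real) \<Rightarrow> 'v \<Rightarrow> 'v \<Rightarrow> real" where
  "tilt q y x = (INF t\<in>{0..}. q (x + t *\<^sub>R y) - t * q y)"

lemma tilt_bdd_below:
  assumes "sublinear q"
  shows "bdd_below ((\<lambda>t. q (x + t *\<^sub>R y) - t * q y) ` {0..})"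
proof (rule bdd_belowI2)
  fix t :: real assume "t \<in> {0..}"
  then show "- q (- x) \<le> q (x + t *\<^sub>R y) - t * q y"
    using sublinear_add[OF assms, of "x + t *\<^sub>R y" "- x"] sublinear_scaleR[OF assms, of t y] by simp
qed

lemma tilt_le: "sublinear q \<Longrightarrow> t \<ge> 0 \<Longrightarrow> tilt q y x \<le> q (x + t *\<^sub>R y) - t * q y"
  unfolding tilt_def by (rule cINF_lower[OF tilt_bdd_below]) auto

lemma tilt_le_self: "sublinear q \<Longrightarrow> tilt q y x \<le> q x"
  using tilt_le[of q 0 y x] by simp

lemma tilt_uminus_le: "sublinear q \<Longrightarrow> tilt q y (- y) \<le> - q y"
  using tilt_le[of q 1 y "- y"] by (simp add: sublinear_0)

lemma tilt_greatest: "(\<And>t. t \<ge> 0 \<Longrightarrow> c \<le> q (x + t *\<^sub>R y) - t * q y) \<Longrightarrow> c \<le> tilt q y x"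
  unfolding tilt_def by (rule cINF_greatest) auto

lemma sublinear_tilt:
  assumes q: "sublinear q"
  shows "sublinear (tilt q y)"
proof (rule sublinearI)
  fix x z
  \<comment> \<open>Parameters \<open>s\<close> and \<open>t\<close> for the two summands combine to
    \<open>s + t\<close> for the sum; the two infima are taken one after the other.\<close>
  have "tilt q y (x + z) - (q (x + s *\<^sub>R y) - s * q y) \<le> tilt q y z" if s: "s \<ge> 0" for s
  proof (rule tilt_greatest)
    fix t :: real assume t: "t \<ge> 0"
    have "tilt q y (x + z) \<le> q ((x + z) + (s + t) *\<^sub>R y) - (s + t) * q y"
      using s t by (intro tilt_le q) auto
    also have "(x + z) + (s + t) *\<^sub>R y = (x + s *\<^sub>R y) + (z + t *\<^sub>R y)"
      by (simp add: algebra_simps)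
    finally show "tilt q y (x + z) - (q (x + s *\<^sub>R y) - s * q y) \<le> q (z + t *\<^sub>R y) - t * q y"
      using sublinear_add[OF q, of "x + s *\<^sub>R y" "z + t *\<^sub>R y"] by (simp add: algebra_simps)
  qed
  then have "tilt q y (x + z) - tilt q y z \<le> tilt q y x"
    by (intro tilt_greatest) (simp add: algebra_simps)
  then show "tilt q y (x + z) \<le> tilt q y x + tilt q y z" by simp
next
  show "tilt q y 0 = 0"
    unfolding tilt_def using q by (simp add: sublinear_scaleR)
next
  fix r :: real and x assume r: "r > 0"
  have "tilt q y (r *\<^sub>R x) / r \<le> tilt q y x"
  proof (rule tilt_greatest)
    fix t :: real assume t: "t \<ge> 0"
    have "tilt q y (r *\<^sub>R x) \<le> q (r *\<^sub>R x + (r * t) *\<^sub>R y) - (r * t) * q y"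
      using r t by (intro tilt_le q) auto
    also have "r *\<^sub>R x + (r * t) *\<^sub>R y = r *\<^sub>R (x + t *\<^sub>R y)"
      by (simp add: algebra_simps)
    also have "q (r *\<^sub>R (x + t *\<^sub>R y)) = r * q (x + t *\<^sub>R y)"
      using r by (intro sublinear_scaleR q) auto
    finally show "tilt q y (r *\<^sub>R x) / r \<le> q (x + t *\<^sub>R y) - t * q y"
      using r by (simp add: field_simps)
  qed
  then show "tilt q y (r *\<^sub>R x) \<le> r * tilt q y x" using r by (simp add: field_simps)
qed

text \<open>The infimum is finite because every sublinear \<open>q \<le> p\<close> satisfies
  \<open>q x \<ge> - p (- x)\<close>. Subadditivity uses the chain: any two members have a member
  below both, which serves for both summands.\<close>

lemma sublinear_minorant_chain:
  fixes p :: "'v::real_vector \<Rightarrow> real"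
  assumes "C \<noteq> {}" and C: "\<And>q. q \<in> C \<Longrightarrow> sublinear q \<and> q \<le> p"
    and chain: "\<And>q q'. q \<in> C \<Longrightarrow> q' \<in> C \<Longrightarrow> q \<le> q' \<or> q' \<le> q"
  defines "u \<equiv> \<lambda>x. INF q\<in>C. q x"
  shows "sublinear u" and "\<And>q. q \<in> C \<Longrightarrow> u \<le> q"
proof -
  have le: "u x \<le> q x" if "q \<in> C" for q x
    unfolding u_def
  proof (rule cINF_lower[OF _ that], rule bdd_belowI2)
    fix q assume "q \<in> C"
    then show "- p (- x) \<le> q x"
      using sublinear_lower[of q x] C[of q] le_funD[of q p "- x"] by fastforce
  qed
  have ge: "c \<le> u x" if "\<And>q. q \<in> C \<Longrightarrow> c \<le> q x" for c x
    unfolding u_def using assms(1) that by (rule cINF_greatest)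
  show "u \<le> q" if "q \<in> C" for q using le[OF that] by (rule le_funI)
  show "sublinear u"
  proof (rule sublinearI)
    fix x z
    have *: "u (x + z) \<le> q x + q' z" if q: "q \<in> C" "q' \<in> C" for q q'
    proof -
      obtain m where m: "m \<in> C" "m \<le> q" "m \<le> q'" using chain[OF q] q by blast
      have "u (x + z) \<le> m x + m z"
        using le[OF m(1), of "x + z"] sublinear_add[of m x z] C[OF m(1)] by linarith
      then show ?thesis using le_funD[OF m(2), of x] le_funD[OF m(3), of z] by linarith
    qed
    have "u (x + z) - q' z \<le> u x" if "q' \<in> C" for q'
      by (rule ge) (use * that in \<open>simp add: algebra_simps\<close>)
    then have "u (x + z) - u x \<le> u z"
      by (intro ge) (simp add: algebra_simps)
    then show "u (x + z) \<le> u x + u z" by simp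
  next
    show "u 0 = 0"
      unfolding u_def using assms(1) C by (simp add: sublinear_0)
  next
    fix r :: real and x assume r: "r > 0"
    have "u (r *\<^sub>R x) / r \<le> u x"
    proof (rule ge)
      fix q assume q: "q \<in> C"
      show "u (r *\<^sub>R x) / r \<le> q x"
        using le[OF q, of "r *\<^sub>R x"] sublinear_scaleR[of q r x] C[OF q] r by (simp add: field_simps)
    qed
    then show "u (r *\<^sub>R x) \<le> r * u x" using r by (simp add: field_simps)
  qed
qed

text \<open>Zorn's lemma for the reversed order: upper bounds of chains are pointwise infima, and a
  maximal element is a minimal functional.\<close>

lemma exists_minimal_sublinear:
  fixes p :: "'v::real_vector \<Rightarrow> real"
  assumes p: "sublinear p"
  obtains m where "sublinear m" "m \<le> p" "\<And>q. sublinear q \<Longrightarrow> q \<le> m \<Longrightarrow> q = m"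
proof -
  let ?A = "{q. sublinear q \<and> q \<le> p}"
  let ?P = "\<lambda>q r :: 'v \<Rightarrow> real. r \<le> q"
  have po: "partial_order_on ?A (relation_of ?P ?A)"
    by (rule partial_order_on_relation_ofI) auto
  have "\<exists>m\<in>?A. \<forall>q\<in>?A. ?P m q \<longrightarrow> q = m"
  proof (rule predicate_Zorn[OF po])
    fix C assume "C \<in> Chains (relation_of ?P ?A)"
    then have C: "\<And>q. q \<in> C \<Longrightarrow> sublinear q \<and> q \<le> p"
        "\<And>q q'. q \<in> C \<Longrightarrow> q' \<in> C \<Longrightarrow> q \<le> q' \<or> q' \<le> q"
      unfolding Chains_def relation_of_def by blast+
    show "\<exists>u\<in>?A. \<forall>q\<in>C. ?P q u"
    proof (cases "C = {}")
      case True
      then show ?thesis using p by auto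
    next
      case False
      have u: "sublinear (\<lambda>x. INF q\<in>C. q x)" "\<And>q. q \<in> C \<Longrightarrow> (\<lambda>x. INF q\<in>C. q x) \<le> q"
        by (rule sublinear_minorant_chain[OF False, of p]; use C in blast)+
      from False obtain q where q: "q \<in> C" by blast
      have "(\<lambda>x. INF q\<in>C. q x) \<le> p"
        using u(2)[OF q] C(1)[OF q] by (meson order_trans)
      then show ?thesis using u by blast
    qed
  qed
  then show thesis using that by (auto intro: order_trans)
qed

text \<open>A minimal sublinear functional coincides with all its tilts, hence it is odd.\<close>

lemma hahn_banach_sublinear:
  fixes p :: "'v::real_vector \<Rightarrow> real"
  assumes p: "sublinear p"
  obtains f where "linear f" "\<And>x. f x \<le> p x" "f a = p a"
proof -
  \<comment> \<open>Minimality is sought below \<open>tilt p a\<close>, not just below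
    \<open>p\<close>: this gives \<open>m (- a) \<le> - p a\<close> and, with oddness,
    \<open>m a = p a\<close>.\<close>
  obtain m where m: "sublinear m" "m \<le> tilt p a" "\<And>q. sublinear q \<Longrightarrow> q \<le> m \<Longrightarrow> q = m"
    using exists_minimal_sublinear[OF sublinear_tilt[OF p, of a]] by blast
  have odd: "m (- y) = - m y" for y
  proof (rule antisym)
    have "tilt m y = m"
      by (rule m(3)[OF sublinear_tilt[OF m(1)]]) (simp add: le_funI tilt_le_self m(1))
    then show "m (- y) \<le> - m y" using tilt_uminus_le[OF m(1), of y] by simp
    show "- m y \<le> m (- y)" using sublinear_lower[OF m(1), of y] by simp
  qed
  have mp: "m x \<le> p x" for x
    using le_funD[OF m(2), of x] tilt_le_self[OF p, of a x] by simp
  show thesis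
  proof (rule that)
    show "linear m"
    proof (rule linearI)
      show "m (x + y) = m x + m y" for x y
        using sublinear_add[OF m(1), of x y] sublinear_add[OF m(1), of "- x" "- y"] odd[of "x + y"]
        by (simp add: odd)
      show "m (r *\<^sub>R x) = r *\<^sub>R m x" for r x
      proof (cases "r \<ge> 0")
        case True
        then show ?thesis using sublinear_scaleR[OF m(1)] by simp
      next
        case False
        then have "m ((- r) *\<^sub>R x) = (- r) * m x" by (intro sublinear_scaleR m(1)) simp
        then show ?thesis using odd[of "r *\<^sub>R x"] by simp
      qed
    qed
    have "m (- a) \<le> - p a"
      using le_funD[OF m(2), of "- a"] tilt_uminus_le[OF p, of a] by simp
    then show "m a = p a" using odd[of a] mp[of a] by simp
  qed (rule mp)
qed

section \<open>Positive functionals\<close>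

lemma positive_element_imp_psd:
  fixes a :: "'a::unital_cstar_algebra"
  assumes "positive_element a"
  shows "psd a"
  unfolding psd_def
proof (intro conjI allI impI)
  show "star a = a" using assms unfolding positive_element_def by simp
  fix \<epsilon> :: real assume \<epsilon>: "\<epsilon> > 0"
  then have "complex_of_real (- \<epsilon>) \<notin> cstar_spectrum a"
    using assms unfolding positive_element_def by (auto simp: complex_nonneg_Reals_iff)
  then obtain y where y: "(scaleC (complex_of_real (- \<epsilon>)) 1 - a) * y = 1"
      "y * (scaleC (complex_of_real (- \<epsilon>)) 1 - a) = 1"
    unfolding cstar_spectrum_def by blast
  have "scaleC (complex_of_real (- \<epsilon>)) 1 - a = - (a + of_real \<epsilon>)"
    by (simp only: scaleC_of_real) (simp add: of_real_def)
  with y have "- (a + of_real \<epsilon>) * y = 1" "y * - (a + of_real \<epsilon>) = 1"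
    by (simp_all only:)
  then show "has_inverse (a + of_real \<epsilon>)"
    by (intro has_inverseI[of _ "- y" "- y"]) (simp_all only: mult_minus_left mult_minus_right)
qed

lemma psd_of_real_imp_nonneg:
  assumes "psd (of_real r :: 'a::unital_cstar_algebra)"
  shows "r \<ge> 0"
proof (rule ccontr)
  assume "\<not> r \<ge> 0"
  then have "- r > 0" by simp
  then have "has_inverse (of_real r + of_real (- r) :: 'a)"
    using assms unfolding psd_def by blast
  then show False by (auto elim: has_inverseE)
qed

text \<open>The largest spectral value of \<open>x + star x\<close>. A linear functional below it is
  non-negative on positive elements and invariant under \<open>star\<close>.\<close>

definition upper_bound_functional :: "'a::unital_cstar_algebra \<Rightarrow> real" where
  "upper_bound_functional x = Inf {t. psd (of_real t - (x + star x))}"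

lemma upper_bound_functional_bdd_below:
  "bdd_below {t. psd (of_real t - (x + star (x::'a::unital_cstar_algebra)))}"
proof (rule bdd_belowI)
  fix t assume "t \<in> {t. psd (of_real t - (x + star x))}"
  moreover have "psd (of_real (norm (x + star x)) - (- (x + star x)))"
    by (rule psd_of_real_minus) (simp_all only: star_minus star_add star_star
        add.commute norm_minus_cancel order_refl)
  ultimately have "psd ((of_real t - (x + star x)) + (of_real (norm (x + star x)) - (- (x + star x))))"
    by (intro psd_add) auto
  then have "psd (of_real (t + norm (x + star x)) :: 'a)" by simp
  then show "- norm (x + star x) \<le> t"
    using psd_of_real_imp_nonneg[of "t + norm (x + star x)", where 'a = 'a] by simp
qed

lemma upper_bound_functional_le:
  "psd (of_real t - (x + star x)) \<Longrightarrow> upper_bound_functional x \<le> t"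
  unfolding upper_bound_functional_def
  by (rule cInf_lower[OF _ upper_bound_functional_bdd_below]) simp

lemma psd_norm_minus_add_star:
  "psd (of_real (norm (x + star x)) - (x + star (x::'a::unital_cstar_algebra)))"
  by (rule psd_of_real_minus) (simp_all add: star_add star_star add.commute)

lemma upper_bound_functional_greatest:
  "(\<And>t. psd (of_real t - (x + star x)) \<Longrightarrow> c \<le> t) \<Longrightarrow> c \<le> upper_bound_functional x"
  unfolding upper_bound_functional_def
  using psd_norm_minus_add_star by (intro cInf_greatest) auto

lemma sublinear_upper_bound_functional:
  "sublinear (upper_bound_functional :: 'a::unital_cstar_algebra \<Rightarrow> real)"
proof (rule sublinearI)
  fix x y :: 'a
  have "upper_bound_functional (x + y) - s \<le> upper_bound_functional y"
    if s: "psd (of_real s - (x + star x))" for s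
  proof (rule upper_bound_functional_greatest)
    fix t assume t: "psd (of_real t - (y + star y))"
    have "psd ((of_real s - (x + star x)) + (of_real t - (y + star y)))"
      using s t by (rule psd_add)
    also have "(of_real s - (x + star x)) + (of_real t - (y + star y))
        = of_real (s + t) - ((x + y) + star (x + y))"
      by (simp add: star_add)
    finally show "upper_bound_functional (x + y) - s \<le> t"
      using upper_bound_functional_le by fastforce
  qed
  then have "upper_bound_functional (x + y) - upper_bound_functional y \<le> upper_bound_functional x"
    by (intro upper_bound_functional_greatest) (simp add: algebra_simps)
  then show "upper_bound_functional (x + y) \<le> upper_bound_functional x + upper_bound_functional y"
    by simp
next
  show "upper_bound_functional (0::'a) = 0"
  proof (rule antisym)
    show "upper_bound_functional (0::'a) \<le> 0"
      by (rule upper_bound_functional_le) (use psd_of_real[of 0] in simp)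
    show "0 \<le> upper_bound_functional (0::'a)"
      by (rule upper_bound_functional_greatest) (use psd_of_real_imp_nonneg[where 'a = 'a] in simp)
  qed
next
  fix r :: real and x :: 'a assume r: "r > 0"
  have "upper_bound_functional (r *\<^sub>R x) / r \<le> upper_bound_functional x"
  proof (rule upper_bound_functional_greatest)
    fix t assume t: "psd (of_real t - (x + star x))"
    have "psd (r *\<^sub>R (of_real t - (x + star x)))"
      using t r by (intro psd_scaleR) auto
    also have "r *\<^sub>R (of_real t - (x + star x)) = of_real (r * t) - (r *\<^sub>R x + star (r *\<^sub>R x))"
      by (simp add: scaleR_right_diff_distrib scaleR_right_distrib) (simp add: scaleR_conv_of_real)
    finally have "upper_bound_functional (r *\<^sub>R x) \<le> r * t"
      by (rule upper_bound_functional_le)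
    then show "upper_bound_functional (r *\<^sub>R x) / r \<le> t" using r by (simp add: field_simps)
  qed
  then show "upper_bound_functional (r *\<^sub>R x) \<le> r * upper_bound_functional x"
    using r by (simp add: field_simps)
qed

text \<open>A value of at most 0 would make both \<open>a + star a\<close> and its negative
  positive; the norm bound with \<open>t = 0\<close> then gives \<open>a = 0\<close>.\<close>

lemma upper_bound_functional_pos:
  fixes a :: "'a::unital_cstar_algebra"
  assumes a: "psd a" and "a \<noteq> 0"
  shows "upper_bound_functional a > 0"
proof (rule ccontr)
  assume "\<not> upper_bound_functional a > 0"
  then have le: "upper_bound_functional a \<le> 0" by simp
  have "psd (- (a + star a))"
  proof (rule psd_if_shifts_psd)
    fix \<epsilon> :: real assume "\<epsilon> > 0"
    with le have "Inf {t. psd (of_real t - (a + star a))} < \<epsilon>"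
      unfolding upper_bound_functional_def by simp
    then obtain t where t: "psd (of_real t - (a + star a))" "t < \<epsilon>"
      using cInf_lessD[of "{t. psd (of_real t - (a + star a))}" \<epsilon>]
        psd_norm_minus_add_star[of a] by auto
    have "psd ((of_real t - (a + star a)) + of_real (\<epsilon> - t))"
      using t by (intro psd_add psd_of_real) auto
    then show "psd (- (a + star a) + of_real \<epsilon>)" by (simp add: algebra_simps)
  qed
  moreover have "psd (a + star a)"
    using a psd_star[OF a] by (simp add: psd_add)
  ultimately have "norm (a + star a) \<le> 0"
    by (intro norm_le_if_psd) auto
  then have "2 *\<^sub>R a = 0" using psd_star[OF a] by (simp add: scaleR_2)
  with \<open>a \<noteq> 0\<close> show False by simp
qed

text \<open>Hahn--Banach is applied at \<open>a\<close>, where the dominating functional is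
  positive. The real functional \<open>f\<close> is star-invariant, so \<open>f (i h) = 0\<close>
  for self-adjoint \<open>h\<close>; hence its complexification agrees with \<open>f\<close> on
  self-adjoint elements.\<close>

lemma exists_positive_functional:
  fixes a :: "'a::unital_cstar_algebra"
  assumes a: "psd a" and "a \<noteq> 0"
  obtains \<phi> r where "positive_functional \<phi>" "\<phi> a = complex_of_real r" "r > 0"
proof -
  let ?p = "upper_bound_functional :: 'a \<Rightarrow> real"
  obtain f where f: "linear f" "\<And>x. f x \<le> ?p x" "f a = ?p a"
    using hahn_banach_sublinear[OF sublinear_upper_bound_functional, of a] by metis
  interpret f: linear f by (rule f(1))
  have f_psd: "f h \<ge> 0" if h: "psd h" for h
  proof -
    have "?p (- h) \<le> 0"
      using psd_add[OF h h] psd_star[OF h] by (intro upper_bound_functional_le) simp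
    then show ?thesis using f(2)[of "- h"] by (simp add: f.neg)
  qed
  have f_star: "f (star x) = f x" for x
  proof -
    have "?p (star x - x) \<le> 0" "?p (x - star x) \<le> 0"
      using psd_of_real[of 0] by (auto intro!: upper_bound_functional_le simp: star_star)
    then show ?thesis using f(2)[of "star x - x"] f(2)[of "x - star x"] by (simp add: f.diff)
  qed
  have f_le: "f x \<le> 2 * norm x" for x
  proof -
    have "f x \<le> norm (x + star x)"
      using f(2)[of x] upper_bound_functional_le[OF psd_norm_minus_add_star, of x] by simp
    also have "\<dots> \<le> 2 * norm x" using norm_triangle_ineq[of x "star x"] by simp
    finally show ?thesis .
  qed
  have f_bound: "\<bar>f x\<bar> \<le> 2 * norm x" for x
    using f_le[of x] f_le[of "- x"] by (simp add: f.neg)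
  have f_i: "f (scaleC \<i> h) = 0" if "star h = h" for h
    using f_star[of "scaleC \<i> h"] that by (simp add: star_scaleC scaleC_uminus_left f.neg)
  define \<phi> where "\<phi> x = Complex (f x) (- f (scaleC \<i> x))" for x
  have C: "\<phi> (scaleC c x) = c * \<phi> x" for c x
  proof -
    have "scaleC c x = scaleC (complex_of_real (Re c) + complex_of_real (Im c) * \<i>) x"
      by (metis complex_eq mult.commute)
    also have "\<dots> = Re c *\<^sub>R x + Im c *\<^sub>R scaleC \<i> x"
      by (simp add: scaleC_add_left scaleC_scaleC[symmetric] scaleC_of_real)
    finally have c: "scaleC c x = Re c *\<^sub>R x + Im c *\<^sub>R scaleC \<i> x" .
    show ?thesis
      unfolding \<phi>_def c
      by (simp add: complex_eq_iff f.add f.scale scaleC_add_right scaleC_scaleR scaleC_scaleC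
          scaleC_uminus_left f.neg f.diff)
  qed
  have "bounded_linear \<phi>"
  proof (rule bounded_linear_intro[where K = 4])
    show "\<phi> (x + y) = \<phi> x + \<phi> y" for x y
      unfolding \<phi>_def by (simp add: complex_eq_iff f.add scaleC_add_right)
    show "\<phi> (r *\<^sub>R x) = r *\<^sub>R \<phi> x" for r x
      unfolding \<phi>_def by (simp add: complex_eq_iff f.scale scaleC_scaleR)
    show "norm (\<phi> x) \<le> norm x * 4" for x
      using cmod_le[of "\<phi> x"] f_bound[of x] f_bound[of "scaleC \<i> x"]
      unfolding \<phi>_def by (simp add: norm_scaleC)
  qed
  moreover have "\<phi> (star x * x) \<in> \<real>\<^sub>\<ge>\<^sub>0" for x
    unfolding \<phi>_def complex_nonneg_Reals_iff
    using f_psd[OF psd_star_mult[of x]] f_i[of "star x * x"] by (simp add: star_mult star_star)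
  ultimately have "positive_functional \<phi>"
    unfolding positive_functional_def cstar_dual_def using C by simp
  moreover have "\<phi> a = complex_of_real (?p a)"
    unfolding \<phi>_def by (simp add: f(3) f_i[OF psd_star[OF a]] complex_eq_iff)
  ultimately show thesis
    using that upper_bound_functional_pos[OF assms] by blast
qed

lemma positive_functional_linear: "positive_functional \<phi> \<Longrightarrow> bounded_linear \<phi>"
  unfolding positive_functional_def cstar_dual_def by simp

lemma positive_functional_scaleC: "positive_functional \<phi> \<Longrightarrow> \<phi> (scaleC c x) = c * \<phi> x"
  unfolding positive_functional_def cstar_dual_def by simp

lemma positive_functional_nonneg: "positive_functional \<phi> \<Longrightarrow> \<phi> (star x * x) \<in> \<real>\<^sub>\<ge>\<^sub>0"
  unfolding positive_functional_def by simp

lemma a_states_nonempty: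
  fixes a :: "'a::unital_cstar_algebra"
  assumes "psd a" "a \<noteq> 0"
  shows "a_states a \<noteq> {}"
proof -
  obtain \<phi> r where \<phi>: "positive_functional \<phi>" "\<phi> a = complex_of_real r" "r > 0"
    using exists_positive_functional[OF assms] .
  define \<psi> where "\<psi> x = (1/r) *\<^sub>R \<phi> x" for x
  have "bounded_linear \<psi>"
    unfolding \<psi>_def
    by (rule bounded_linear_compose[OF bounded_linear_scaleR_right positive_functional_linear[OF \<phi>(1)]])
  then have "positive_functional \<psi>"
    using positive_functional_scaleC[OF \<phi>(1)] positive_functional_nonneg[OF \<phi>(1)] \<phi>(3)
    unfolding positive_functional_def cstar_dual_def \<psi>_def by (auto simp: complex_nonneg_Reals_iff)
  moreover have "\<psi> a = 1" unfolding \<psi>_def \<phi>(2) using \<phi>(3) by (simp add: scaleR_conv_of_real)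
  ultimately show ?thesis unfolding a_states_def by blast
qed

text \<open>Each \<open>a + \<epsilon>\<close> is the square of a self-adjoint \<open>d * d\<close>,
  so conjugating it by \<open>u\<close> gives an element of the form \<open>star z * z\<close>; then
  \<open>\<epsilon>\<close> tends to 0.\<close>

lemma positive_functional_conjugate_nonneg:
  fixes a :: "'a::unital_cstar_algebra"
  assumes \<phi>: "positive_functional \<phi>" and a: "psd a"
  shows "\<phi> (star u * a * u) \<in> \<real>\<^sub>\<ge>\<^sub>0"
proof -
  interpret \<phi>: bounded_linear \<phi> using \<phi> by (rule positive_functional_linear)
  let ?z = "\<phi> (star u * a * u)" and ?w = "\<phi> (star u * u)"
  have w: "Re ?w \<ge> 0" "Im ?w = 0"
    using positive_functional_nonneg[OF \<phi>, of u] by (auto simp: complex_nonneg_Reals_iff)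
  have *: "?z + \<epsilon> *\<^sub>R ?w \<in> \<real>\<^sub>\<ge>\<^sub>0" if \<epsilon>: "\<epsilon> > 0" for \<epsilon>
  proof -
    obtain d where d: "star d = d" "(d * d) * (d * d) = a + of_real \<epsilon>"
      by (rule psd_fourth_root[OF a \<epsilon>])
    have "star (d * d * u) * (d * d * u) = star u * ((d * d) * (d * d)) * u"
      by (simp add: star_mult d(1) mult.assoc)
    also have "\<dots> = star u * a * u + \<epsilon> *\<^sub>R (star u * u)"
      unfolding d(2) by (simp add: of_real_def distrib_left distrib_right)
    finally show ?thesis
      using positive_functional_nonneg[OF \<phi>, of "d * d * u"] by (simp add: \<phi>.add \<phi>.scaleR)
  qed
  have "Im ?z = 0" using *[of 1] w by (simp add: complex_nonneg_Reals_iff)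
  moreover have "Re ?z \<ge> 0"
  proof (rule field_le_epsilon)
    fix e :: real assume e: "e > 0"
    \<comment> \<open>The \<open>+ 1\<close> keeps the denominator positive when
      \<open>Re ?w = 0\<close>.\<close>
    have "Re ?z + e / (Re ?w + 1) * Re ?w \<ge> 0"
      using *[of "e / (Re ?w + 1)"] e w by (simp add: complex_nonneg_Reals_iff)
    moreover have "e / (Re ?w + 1) * Re ?w \<le> e"
      using e w by (simp add: field_simps)
    ultimately show "0 \<le> Re ?z + e" by linarith
  qed
  ultimately show ?thesis by (simp add: complex_nonneg_Reals_iff)
qed

section \<open>The semi-inner product of a state\<close>

lemma is_a_adjoint_sym:
  fixes a :: "'a::unital_cstar_algebra"
  assumes "star a = a" "is_a_adjoint a x x'"
  shows "is_a_adjoint a x' x"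
  using arg_cong[OF assms(2)[unfolded is_a_adjoint_def], of star] assms(1)
  unfolding is_a_adjoint_def by (simp add: star_mult star_star)

lemma is_a_adjoint_mult:
  assumes "is_a_adjoint a x x'" "is_a_adjoint a y y'"
  shows "is_a_adjoint a (x * y) (y' * x')"
  using assms unfolding is_a_adjoint_def star_mult by (metis mult.assoc)

lemma is_a_adjoint_add:
  "is_a_adjoint a x x' \<Longrightarrow> is_a_adjoint a y y' \<Longrightarrow> is_a_adjoint a (x + y) (x' + y')"
  unfolding is_a_adjoint_def by (simp add: star_add distrib_left distrib_right)

lemma is_a_adjoint_scaleR: "is_a_adjoint a x x' \<Longrightarrow> is_a_adjoint a (r *\<^sub>R x) (r *\<^sub>R x')"
  unfolding is_a_adjoint_def by simp

lemma is_a_adjoint_sum: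
  "(\<And>j. j \<in> J \<Longrightarrow> is_a_adjoint a (f j) (g j)) \<Longrightarrow> is_a_adjoint a (\<Sum>j\<in>J. f j) (\<Sum>j\<in>J. g j)"
  unfolding is_a_adjoint_def by (simp add: star_sum sum_distrib_left sum_distrib_right)

lemma is_a_adjoint_power: "is_a_adjoint a z z \<Longrightarrow> is_a_adjoint a (z ^ n) (z ^ n)"
proof (induction n)
  case (Suc n)
  from is_a_adjoint_mult[OF Suc.prems Suc.IH[OF Suc.prems]] show ?case
    by (simp add: power_commutes)
qed (simp add: is_a_adjoint_def)

lemma is_a_adjoint_adjoint_mult_self:
  fixes a :: "'a::unital_cstar_algebra"
  assumes "star a = a" "is_a_adjoint a x x'"
  shows "is_a_adjoint a (x' * x) (x' * x)"
  by (rule is_a_adjoint_mult[OF is_a_adjoint_sym[OF assms] assms(2)])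

section \<open>The form of an a-state and its inequalities\<close>

locale a_state =
  fixes a :: "'a::unital_cstar_algebra" and \<phi> :: "'a \<Rightarrow> complex"
  assumes psd_a: "psd a" and state: "\<phi> \<in> a_states a"
begin

lemma pos: "positive_functional \<phi>" and normalised: "\<phi> a = 1"
  using state unfolding a_states_def by auto

sublocale bounded_linear \<phi> using pos by (rule positive_functional_linear)

lemma star_a: "star a = a" by (rule psd_star[OF psd_a])

definition form :: "'a \<Rightarrow> 'a \<Rightarrow> complex" where
  "form u v = \<phi> (star u * a * v)"

definition nrm :: "'a \<Rightarrow> real" where
  "nrm u = sqrt (Re (form u u))"

lemma form_add: "form (u + v) w = form u w + form v w" "form w (u + v) = form w u + form w v"
  unfolding form_def by (simp_all add: star_add distrib_left distrib_right add)

lemma form_diff: "form (u - v) w = form u w - form v w" "form w (u - v) = form w u - form w v"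
  unfolding form_def by (simp_all add: left_diff_distrib right_diff_distrib diff)

lemma form_scaleC: "form (scaleC c u) w = cnj c * form u w" "form w (scaleC c u) = c * form w u"
  unfolding form_def
  by (simp_all add: star_scaleC scaleC_mult_left scaleC_mult_right positive_functional_scaleC[OF pos])

lemma form_self: "Re (form u u) \<ge> 0" "Im (form u u) = 0"
  using positive_functional_conjugate_nonneg[OF pos psd_a, of u]
  unfolding form_def by (auto simp: complex_nonneg_Reals_iff)

lemma nrm_nonneg: "nrm u \<ge> 0"
  unfolding nrm_def by (simp add: form_self)

lemma form_self_eq: "form u u = of_real ((nrm u)\<^sup>2)"
  unfolding nrm_def by (simp add: form_self complex_eq_iff)

text \<open>Polarisation: the form is real on the diagonal, and its values at \<open>u + v\<close>
  and \<open>u + i v\<close> settle the imaginary and the real part.\<close>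

lemma form_cnj: "form v u = cnj (form u v)"
proof -
  have "Im (form u v + form v u) = 0"
    using form_self(2)[of "u + v"] form_self(2)[of u] form_self(2)[of v] by (simp add: form_add)
  moreover have "Re (form u v - form v u) = 0"
    using form_self(2)[of "u + scaleC \<i> v"] form_self(2)[of u] form_self(2)[of v]
    by (simp add: form_add form_scaleC)
  ultimately show ?thesis by (simp add: complex_eq_iff)
qed

lemma form_Cauchy_Schwarz: "cmod (form u v) \<le> nrm u * nrm v"
proof -
  let ?s = "form u v"
  define m where "m = (cmod ?s)\<^sup>2"
  have ss: "?s * cnj ?s = of_real m" unfolding m_def by (metis complex_norm_square)
  have pos: "(nrm u)\<^sup>2 - 2 * t * m + t\<^sup>2 * m * (nrm v)\<^sup>2 \<ge> 0" for t
  proof -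
    let ?c = "of_real t * cnj ?s"
    have "form (u - scaleC ?c v) (u - scaleC ?c v)
        = form u u - of_real t * (?s * cnj ?s) - of_real t * (?s * cnj ?s)
          + of_real (t\<^sup>2) * (?s * cnj ?s) * form v v"
      by (simp add: form_diff form_scaleC form_cnj[of v u] algebra_simps power2_eq_square)
    also have "\<dots> = of_real ((nrm u)\<^sup>2 - 2 * t * m + t\<^sup>2 * m * (nrm v)\<^sup>2)"
      unfolding ss form_self_eq by (simp add: algebra_simps)
    finally show ?thesis using form_self(1)[of "u - scaleC ?c v"] by simp
  qed
  have "m \<le> (nrm u)\<^sup>2 * (nrm v)\<^sup>2"
  proof (cases "nrm v = 0")
    case True
    have "m = 0"
    proof (rule ccontr)
      assume "m \<noteq> 0"
      \<comment> \<open>With \<open>nrm v = 0\<close> this value of \<open>t\<close> makes the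
        quadratic equal to -1.\<close>
      then show False using pos[of "((nrm u)\<^sup>2 + 1) / (2 * m)"] True by simp
    qed
    with True show ?thesis by simp
  next
    case False
    then have v: "(nrm v)\<^sup>2 > 0" by simp
    have "t\<^sup>2 * m * n = t * m" if "t = 1 / n" "n > 0" for t n :: real
      using that by (simp add: power2_eq_square)
    then have "(nrm u)\<^sup>2 - m / (nrm v)\<^sup>2 \<ge> 0"
      using pos[of "1 / (nrm v)\<^sup>2"] v by simp
    then show ?thesis using v by (simp add: field_simps)
  qed
  then have "(cmod ?s)\<^sup>2 \<le> (nrm u * nrm v)\<^sup>2" unfolding m_def by (simp add: power_mult_distrib)
  then show ?thesis by (rule power2_le_imp_le) (simp add: nrm_nonneg)
qed

lemma form_one: "form 1 z = \<phi> (a * z)"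
  unfolding form_def by simp

lemma nrm_one: "nrm 1 = 1"
  unfolding nrm_def form_one by (simp add: normalised)

text \<open>The map \<open>v \<mapsto> 2 \<langle>e, v\<rangle> e - v\<close> is a reflection, hence isometric.\<close>

lemma form_Buzano:
  "cmod (form u 1 * form 1 v - (1/2) * form u v) \<le> (1/2) * (nrm u * nrm v)"
proof -
  define w where "w = scaleC (2 * form 1 v) 1 - v"
  have one: "form 1 1 = 1" by (simp add: form_one normalised)
  have "form w w = form v v"
    unfolding w_def
    by (simp add: form_diff form_scaleC one form_cnj[of v 1] algebra_simps)
  then have nw: "nrm w = nrm v" unfolding nrm_def by simp
  have "form u 1 * form 1 v - (1/2) * form u v = (1/2) * form u w"
    unfolding w_def by (simp add: form_diff form_scaleC algebra_simps)
  then have "cmod (form u 1 * form 1 v - (1/2) * form u v) = (1/2) * cmod (form u w)"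
    by (simp only: norm_mult) simp
  also have "\<dots> \<le> (1/2) * (nrm u * nrm v)"
    using form_Cauchy_Schwarz[of u w] nw by simp
  finally show ?thesis .
qed

lemma form_adjoint: "is_a_adjoint a z z' \<Longrightarrow> form z w = \<phi> (a * (z' * w))"
  unfolding form_def is_a_adjoint_def by (simp add: mult.assoc)

lemma cmod_le_nrm: "cmod (\<phi> (a * z)) \<le> nrm z"
  using form_Cauchy_Schwarz[of 1 z] by (simp add: form_one nrm_one)

text \<open>Squaring repeatedly removes the unknown constant \<open>K\<close>, so the bound is uniform over all
  \<open>a\<close>-states.\<close>

lemma cmod_le_norm_self_adjoint:
  assumes z: "is_a_adjoint a z z"
  shows "cmod (\<phi> (a * z)) \<le> norm z"
proof (rule ccontr)
  assume less: "\<not> cmod (\<phi> (a * z)) \<le> norm z"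
  obtain K where K: "\<And>x. cmod (\<phi> x) \<le> norm x * K" "K > 0"
    using pos_bounded by blast
  have z0: "norm z > 0"
    using less by (cases "z = 0") (simp_all add: zero)
  have sq: "(cmod (\<phi> (a * w)))\<^sup>2 \<le> cmod (\<phi> (a * w\<^sup>2))" if w: "is_a_adjoint a w w" for w
  proof -
    have "(cmod (\<phi> (a * w)))\<^sup>2 \<le> (nrm w)\<^sup>2"
      using cmod_le_nrm[of w] by (intro power_mono) auto
    also have "(nrm w)\<^sup>2 = cmod (form w w)"
      unfolding form_self_eq by (simp add: norm_power)
    also have "form w w = \<phi> (a * w\<^sup>2)"
      using form_adjoint[OF w] by (simp add: power2_eq_square)
    finally show ?thesis .
  qed
  have iter: "cmod (\<phi> (a * z)) ^ (2 ^ n) \<le> cmod (\<phi> (a * z ^ (2 ^ n)))" for n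
  proof (induction n)
    case (Suc n)
    have "cmod (\<phi> (a * z)) ^ (2 ^ Suc n) = (cmod (\<phi> (a * z)) ^ (2 ^ n))\<^sup>2"
      by (simp add: power_mult[symmetric] mult.commute)
    also have "\<dots> \<le> (cmod (\<phi> (a * z ^ (2 ^ n))))\<^sup>2"
      by (intro power_mono Suc.IH) auto
    also have "\<dots> \<le> cmod (\<phi> (a * (z ^ (2 ^ n))\<^sup>2))"
      by (rule sq[OF is_a_adjoint_power[OF z]])
    also have "(z ^ (2 ^ n))\<^sup>2 = z ^ (2 ^ Suc n)"
      by (simp add: power_mult[symmetric] mult.commute)
    finally show ?case .
  qed simp
  \<comment> \<open>The iteration bounds all \<open>q ^ (2 ^ n)\<close> by the fixed number
    \<open>norm a * K\<close>, which is impossible for \<open>q > 1\<close>.\<close>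
  define q where "q = cmod (\<phi> (a * z)) / norm z"
  have q: "q > 1" unfolding q_def using less z0 by simp
  obtain n where n: "norm a * K < q ^ n"
    using real_arch_pow[OF q] by blast
  have "cmod (\<phi> (a * z)) ^ (2 ^ n) \<le> norm (a * z ^ (2 ^ n)) * K"
    using iter[of n] K(1)[of "a * z ^ (2 ^ n)"] by linarith
  also have "\<dots> \<le> (norm a * norm z ^ (2 ^ n)) * K"
  proof (intro mult_right_mono)
    have "norm (a * z ^ (2 ^ n)) \<le> norm a * norm (z ^ (2 ^ n))" by (rule norm_mult_ineq)
    also have "\<dots> \<le> norm a * norm z ^ (2 ^ n)" by (intro mult_left_mono norm_power_ineq) auto
    finally show "norm (a * z ^ (2 ^ n)) \<le> norm a * norm z ^ (2 ^ n)" .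
  qed (use K(2) in simp)
  finally have "q ^ (2 ^ n) \<le> norm a * K"
    unfolding q_def using z0 by (simp add: power_divide field_simps)
  moreover have "q ^ n \<le> q ^ (2 ^ n)"
    using q by (intro power_increasing) (auto intro: less_imp_le less_exp)
  ultimately show False using n by linarith
qed

text \<open>The bound does not mention \<open>\<phi>\<close>, so it makes the suprema in
  \<open>a_numerical_radius\<close> and \<open>a_seminorm\<close> finite at adjointable
  elements.\<close>

lemma nrm_le_adjoint:
  assumes "is_a_adjoint a z z'"
  shows "nrm z \<le> sqrt (norm (z' * z))"
proof -
  have "(nrm z)\<^sup>2 = cmod (\<phi> (a * (z' * z)))"
    unfolding form_adjoint[OF assms, symmetric] form_self_eq by (simp add: norm_power)
  also have "\<dots> \<le> norm (z' * z)"
    by (rule cmod_le_norm_self_adjoint[OF is_a_adjoint_adjoint_mult_self[OF star_a assms]])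
  finally show ?thesis by (rule real_le_rsqrt)
qed

lemma cmod_le_a_numerical_radius:
  assumes z: "is_a_adjoint a z z'"
  shows "cmod (\<phi> (a * z)) \<le> a_numerical_radius a z"
  unfolding a_numerical_radius_def
proof (rule cSup_upper)
  show "cmod (\<phi> (a * z)) \<in> {cmod w | w. w \<in> a_numerical_range a z}"
    unfolding a_numerical_range_def using state by blast
  show "bdd_above {cmod w | w. w \<in> a_numerical_range a z}"
  proof (rule bdd_aboveI)
    fix t assume "t \<in> {cmod w | w. w \<in> a_numerical_range a z}"
    then obtain \<psi> where \<psi>: "\<psi> \<in> a_states a" "t = cmod (\<psi> (a * z))"
      unfolding a_numerical_range_def by blast
    then interpret \<psi>: a_state a \<psi> by unfold_locales (rule psd_a)
    show "t \<le> sqrt (norm (z' * z))"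
      using \<psi>.cmod_le_nrm[of z] \<psi>.nrm_le_adjoint[OF z] \<psi>(2) by linarith
  qed
qed

lemma nrm_le_a_seminorm:
  assumes z: "is_a_adjoint a z z'"
  shows "nrm z \<le> a_seminorm a z"
  unfolding a_seminorm_def
proof (rule cSup_upper)
  show "nrm z \<in> {sqrt (Re (\<psi> (star z * a * z))) | \<psi>. \<psi> \<in> a_states a}"
    unfolding nrm_def form_def using state by blast
  show "bdd_above {sqrt (Re (\<psi> (star z * a * z))) | \<psi>. \<psi> \<in> a_states a}"
  proof (rule bdd_aboveI)
    fix t assume "t \<in> {sqrt (Re (\<psi> (star z * a * z))) | \<psi>. \<psi> \<in> a_states a}"
    then obtain \<psi> where \<psi>: "\<psi> \<in> a_states a" "t = sqrt (Re (\<psi> (star z * a * z)))"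
      by blast
    then interpret \<psi>: a_state a \<psi> by unfold_locales (rule psd_a)
    show "t \<le> sqrt (norm (z' * z))"
      using \<psi>.nrm_le_adjoint[OF z] \<psi>(2) unfolding \<psi>.nrm_def \<psi>.form_def by simp
  qed
qed

lemma a_crawford_number_le: "a_crawford_number a z \<le> cmod (\<phi> (a * z))"
  unfolding a_crawford_number_def
proof (rule cInf_lower)
  show "cmod (\<phi> (a * z)) \<in> {cmod w | w. w \<in> a_numerical_range a z}"
    unfolding a_numerical_range_def using state by blast
  show "bdd_below {cmod w | w. w \<in> a_numerical_range a z}"
    by (rule bdd_belowI[of _ 0]) auto
qed

lemma a_crawford_number_nonneg: "a_crawford_number a z \<ge> 0"
  unfolding a_crawford_number_def
proof (rule cInf_greatest)
  show "{cmod w | w. w \<in> a_numerical_range a z} \<noteq> {}"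
    unfolding a_numerical_range_def using state by blast
qed auto

end

section \<open>Inequalities for real numbers\<close>

lemma weighted_Cauchy_Schwarz:
  fixes p s t :: "'i \<Rightarrow> real"
  assumes "\<And>j. j \<in> J \<Longrightarrow> p j \<ge> 0"
  shows "(\<Sum>j\<in>J. p j * (s j * t j))\<^sup>2 \<le> (\<Sum>j\<in>J. p j * (s j)\<^sup>2) * (\<Sum>j\<in>J. p j * (t j)\<^sup>2)"
proof -
  have "(\<Sum>j\<in>J. p j * (s j * t j)) = (\<Sum>j\<in>J. (sqrt (p j) * s j) * (sqrt (p j) * t j))"
  proof (intro sum.cong refl)
    fix j assume j: "j \<in> J"
    have "(sqrt (p j) * s j) * (sqrt (p j) * t j) = (sqrt (p j) * sqrt (p j)) * (s j * t j)"
      by (simp only: ac_simps)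
    then show "p j * (s j * t j) = (sqrt (p j) * s j) * (sqrt (p j) * t j)"
      using assms[OF j] by simp
  qed
  moreover have "(\<Sum>j\<in>J. p j * (s j)\<^sup>2) = (\<Sum>j\<in>J. (sqrt (p j) * s j)\<^sup>2)" for s :: "'i \<Rightarrow> real"
    using assms by (intro sum.cong refl) (simp add: power_mult_distrib)
  ultimately show ?thesis
    by (simp only: Cauchy_Schwarz_ineq_sum)
qed

text \<open>The right-hand side is the mean of \<open>(W\<^sup>2 + N\<^sup>2) / 2\<close> and
  \<open>N\<^sup>2\<close> with weights \<open>1 / (1 + \<mu>)\<close> and
  \<open>\<mu> / (1 + \<mu>)\<close>; the square of \<open>(W + N) / 2\<close> lies below
  both.\<close>

lemma interpolated_square_bound:
  fixes W N L \<mu> :: real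
  assumes "0 \<le> W" "W \<le> N" "0 \<le> L" "L \<le> (W + N) / 2" "\<mu> \<ge> 0"
  shows "L\<^sup>2 \<le> 1 / (2 * (1 + \<mu>)) * W\<^sup>2 + (1 + 2 * \<mu>) / (2 * (1 + \<mu>)) * N\<^sup>2"
proof -
  have "L\<^sup>2 \<le> ((W + N) / 2)\<^sup>2"
    using assms by (intro power_mono) auto
  moreover have "1 / (2 * (1 + \<mu>)) * W\<^sup>2 + (1 + 2 * \<mu>) / (2 * (1 + \<mu>)) * N\<^sup>2 - ((W + N) / 2)\<^sup>2
      = ((W - N)\<^sup>2 + \<mu> * (4 * N\<^sup>2 - (W + N)\<^sup>2)) / (4 * (1 + \<mu>))"
    using assms(5) by (simp add: divide_simps) (simp add: algebra_simps power2_eq_square)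
  moreover have "(W + N)\<^sup>2 \<le> (2 * N)\<^sup>2"
    using assms by (intro power_mono) auto
  then have "0 \<le> ((W - N)\<^sup>2 + \<mu> * (4 * N\<^sup>2 - (W + N)\<^sup>2)) / (4 * (1 + \<mu>))"
    using assms(5) by (intro divide_nonneg_nonneg add_nonneg_nonneg mult_nonneg_nonneg)
      (auto simp: power_mult_distrib)
  ultimately show ?thesis by linarith
qed

text \<open>The factor 4 in the bound on \<open>N\<close> turns the coefficient of
  \<open>N\<^sup>2\<close> into \<open>q\<close>. Since \<open>q \<ge> 1 / 8\<close> for every
  \<open>\<mu> \<ge> 0\<close>, the term \<open>- q * D\<^sup>2\<close> can be weakened to
  \<open>- 1 / 8 * c\<^sup>2\<close>.\<close>

lemma combined_bound:
  fixes L V W N S D c T \<mu> :: real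
  assumes "0 \<le> W" "W \<le> N" "W \<le> V" "0 \<le> L" "L \<le> (W + N) / 2" "\<mu> \<ge> 0"
    and N: "4 * N\<^sup>2 \<le> S\<^sup>2 - D\<^sup>2" and S: "0 \<le> S" "S \<le> T" and c: "0 \<le> c" "c \<le> \<bar>D\<bar>"
  shows "L\<^sup>2 \<le> 1 / (2 * (1 + \<mu>)) * V\<^sup>2 + (1 + 2 * \<mu>) / (8 * (1 + \<mu>)) * T\<^sup>2 - 1 / 8 * c\<^sup>2"
proof -
  define r where "r = 1 / (2 * (1 + \<mu>))"
  define q where "q = (1 + 2 * \<mu>) / (8 * (1 + \<mu>))"
  have r: "r \<ge> 0" and q: "q \<ge> 1 / 8"
    unfolding r_def q_def using \<open>\<mu> \<ge> 0\<close> by (simp_all add: field_simps)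
  have "L\<^sup>2 \<le> 1 / (2 * (1 + \<mu>)) * W\<^sup>2 + (1 + 2 * \<mu>) / (2 * (1 + \<mu>)) * N\<^sup>2"
    using assms by (intro interpolated_square_bound) auto
  also have "\<dots> = r * W\<^sup>2 + q * (4 * N\<^sup>2)"
  proof -
    have "(1 + 2 * \<mu>) / (2 * (1 + \<mu>)) = q * 4"
      unfolding q_def using \<open>\<mu> \<ge> 0\<close> by (simp add: divide_simps) (simp add: algebra_simps)
    then show ?thesis unfolding r_def by simp
  qed
  also have "\<dots> \<le> r * V\<^sup>2 + q * (S\<^sup>2 - D\<^sup>2)"
    using assms(1,3) N r q by (intro add_mono mult_left_mono power_mono) auto
  also have "\<dots> = r * V\<^sup>2 + q * S\<^sup>2 - q * D\<^sup>2"
    by (simp add: right_diff_distrib)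
  also have "\<dots> \<le> r * V\<^sup>2 + q * T\<^sup>2 - 1 / 8 * c\<^sup>2"
  proof (intro diff_mono add_left_mono)
    show "q * S\<^sup>2 \<le> q * T\<^sup>2"
      using S q by (intro mult_left_mono power_mono) auto
    have "c\<^sup>2 \<le> D\<^sup>2" using power_mono[OF c(2,1), of 2] by simp
    then show "1 / 8 * c\<^sup>2 \<le> q * D\<^sup>2"
      using q by (intro mult_mono) auto
  qed
  finally show ?thesis unfolding r_def q_def .
qed

section \<open>The estimate at a single state\<close>

lemma (in a_state) a_state_bound:
  fixes x y x' y' :: "'i \<Rightarrow> 'a"
  assumes x: "\<And>j. j \<in> J \<Longrightarrow> is_a_adjoint a (x j) (x' j)"
    and y: "\<And>j. j \<in> J \<Longrightarrow> is_a_adjoint a (y j) (y' j)"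
    and \<mu>: "\<mu> \<ge> 0"
    and p: "\<And>j. j \<in> J \<Longrightarrow> p j \<ge> 0" "(\<Sum>j\<in>J. p j) = 1"
  shows "cmod (\<phi> (a * (\<Sum>j\<in>J. p j *\<^sub>R (x' j * y j)))) ^ 4
    \<le> 1 / (2 * (1 + \<mu>)) *
        (a_numerical_radius a (\<Sum>j\<in>J. p j *\<^sub>R (y' j * y j * x' j * x j)))\<^sup>2
      + (1 + 2 * \<mu>) / (8 * (1 + \<mu>)) *
        (\<Sum>j\<in>J. p j * a_seminorm a ((x' j * x j)\<^sup>2 + (y' j * y j)\<^sup>2))\<^sup>2
      - 1 / 8 *
        (a_crawford_number a (\<Sum>j\<in>J. p j *\<^sub>R ((x' j * x j)\<^sup>2 - (y' j * y j)\<^sup>2)))\<^sup>2"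
proof -
  define X where "X j = x' j * x j" for j
  define Y where "Y j = y' j * y j" for j
  have XX: "is_a_adjoint a (X j) (X j)" and YY: "is_a_adjoint a (Y j) (Y j)" if "j \<in> J" for j
    unfolding X_def Y_def
    using is_a_adjoint_adjoint_mult_self[OF star_a] x y that by auto
  define L where "L = (\<Sum>j\<in>J. p j * (nrm (x j) * nrm (y j))\<^sup>2)"
  define N where "N = (\<Sum>j\<in>J. p j * (nrm (X j) * nrm (Y j)))"
  define S where "S = (\<Sum>j\<in>J. p j * ((nrm (X j))\<^sup>2 + (nrm (Y j))\<^sup>2))"
  define D where "D = (\<Sum>j\<in>J. p j * ((nrm (X j))\<^sup>2 - (nrm (Y j))\<^sup>2))"
  define w where "w = (\<Sum>j\<in>J. p j *\<^sub>R form (Y j) (X j))"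
  have lin: "\<phi> (a * (\<Sum>j\<in>J. p j *\<^sub>R f j)) = (\<Sum>j\<in>J. p j *\<^sub>R \<phi> (a * f j))" for f
    by (simp add: sum_distrib_left sum scaleR)
  \<comment> \<open>So \<open>L\<close> is the weighted sum of
    \<open>form (Y j) 1 * form 1 (X j)\<close>, the products that Buzano's inequality
    estimates.\<close>
  have nx: "form 1 (X j) = of_real ((nrm (x j))\<^sup>2)" and ny: "form (Y j) 1 = of_real ((nrm (y j))\<^sup>2)"
    if j: "j \<in> J" for j
  proof -
    show "form 1 (X j) = of_real ((nrm (x j))\<^sup>2)"
      unfolding form_one X_def form_adjoint[OF x[OF j], symmetric] form_self_eq ..
    have "form (Y j) 1 = \<phi> (a * (y' j * y j))"
      unfolding form_adjoint[OF YY[OF j]] by (simp add: Y_def)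
    then show "form (Y j) 1 = of_real ((nrm (y j))\<^sup>2)"
      unfolding form_adjoint[OF y[OF j], symmetric] form_self_eq .
  qed
  have nX: "\<phi> (a * (X j)\<^sup>2) = of_real ((nrm (X j))\<^sup>2)" and nY: "\<phi> (a * (Y j)\<^sup>2) = of_real ((nrm (Y j))\<^sup>2)"
    if "j \<in> J" for j
    using form_adjoint[OF XX[OF that], of "X j"] form_adjoint[OF YY[OF that], of "Y j"]
    by (simp_all add: power2_eq_square[of "X j"] power2_eq_square[of "Y j"] form_self_eq)

  have "cmod (\<phi> (a * (\<Sum>j\<in>J. p j *\<^sub>R (x' j * y j)))) \<le> (\<Sum>j\<in>J. p j * (nrm (x j) * nrm (y j)))"
    unfolding lin
  proof (rule sum_norm_le)
    fix j assume j: "j \<in> J"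
    show "norm (p j *\<^sub>R \<phi> (a * (x' j * y j))) \<le> p j * (nrm (x j) * nrm (y j))"
      unfolding form_adjoint[OF x[OF j], symmetric]
      using p(1)[OF j] form_Cauchy_Schwarz by (simp add: mult_left_mono)
  qed
  then have "(cmod (\<phi> (a * (\<Sum>j\<in>J. p j *\<^sub>R (x' j * y j)))))\<^sup>2 \<le> (\<Sum>j\<in>J. p j * (nrm (x j) * nrm (y j)))\<^sup>2"
    by (intro power_mono) auto
  \<comment> \<open>Cauchy--Schwarz against the constant 1, with weights of total mass 1.\<close>
  also have "\<dots> \<le> L"
    using weighted_Cauchy_Schwarz[of J p "\<lambda>j. nrm (x j) * nrm (y j)" "\<lambda>_. 1"] p
    unfolding L_def by simp
  finally have "((cmod (\<phi> (a * (\<Sum>j\<in>J. p j *\<^sub>R (x' j * y j)))))\<^sup>2)\<^sup>2 \<le> L\<^sup>2"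
    by (intro power_mono) auto
  then have LHS: "cmod (\<phi> (a * (\<Sum>j\<in>J. p j *\<^sub>R (x' j * y j)))) ^ 4 \<le> L\<^sup>2"
    by (simp add: power_mult[symmetric])

  have L0: "L \<ge> 0" unfolding L_def by (intro sum_nonneg mult_nonneg_nonneg p) auto
  have LWN: "L \<le> (cmod w + N) / 2"
  proof -
    \<comment> \<open>The terms \<open>form (Y j) (X j)\<close> are summed inside the norm, so that
      only \<open>cmod w\<close> occurs; this is what the numerical radius controls.\<close>
    have "of_real L - (1/2) * w
        = (\<Sum>j\<in>J. p j *\<^sub>R (form (Y j) 1 * form 1 (X j) - (1/2) * form (Y j) (X j)))"
      unfolding L_def w_def
      by (simp add: nx ny sum_distrib_left sum_subtractf[symmetric] scaleR_conv_of_real algebra_simps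
          power_mult_distrib cong: sum.cong)
    also have "cmod \<dots> \<le> (\<Sum>j\<in>J. p j * ((1/2) * (nrm (Y j) * nrm (X j))))"
    proof (rule sum_norm_le)
      fix j assume j: "j \<in> J"
      show "cmod (p j *\<^sub>R (form (Y j) 1 * form 1 (X j) - (1/2) * form (Y j) (X j)))
          \<le> p j * ((1/2) * (nrm (Y j) * nrm (X j)))"
        unfolding norm_scaleR abs_of_nonneg[OF p(1)[OF j]]
        by (rule mult_left_mono[OF form_Buzano p(1)[OF j]])
    qed
    also have "\<dots> = N / 2"
      unfolding N_def by (simp add: sum_divide_distrib mult.commute mult.left_commute)
    finally have "cmod (of_real L - (1/2) * w) \<le> N / 2" .
    moreover have "cmod (of_real L) \<le> cmod (of_real L - (1/2) * w) + cmod ((1/2) * w)"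
      using norm_triangle_ineq[of "of_real L - (1/2) * w" "(1/2) * w"] by simp
    ultimately show ?thesis using L0 by (simp add: norm_mult)
  qed
  have wN: "cmod w \<le> N"
    unfolding w_def N_def
    by (rule sum_norm_le)
      (use p(1) form_Cauchy_Schwarz in \<open>simp add: mult_left_mono mult.commute[of "nrm (X _)"]\<close>)
  have wV: "cmod w \<le> a_numerical_radius a (\<Sum>j\<in>J. p j *\<^sub>R (y' j * y j * x' j * x j))"
  proof -
    have eq: "(\<Sum>j\<in>J. p j *\<^sub>R (y' j * y j * x' j * x j)) = (\<Sum>j\<in>J. p j *\<^sub>R (Y j * X j))"
      by (simp add: X_def Y_def mult.assoc)
    have "w = \<phi> (a * (\<Sum>j\<in>J. p j *\<^sub>R (Y j * X j)))"
      unfolding lin w_def by (intro sum.cong refl) (simp add: form_adjoint[OF YY])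
    moreover have "is_a_adjoint a (\<Sum>j\<in>J. p j *\<^sub>R (Y j * X j)) (\<Sum>j\<in>J. p j *\<^sub>R (X j * Y j))"
      by (intro is_a_adjoint_sum is_a_adjoint_scaleR is_a_adjoint_mult XX YY)
    ultimately show ?thesis unfolding eq using cmod_le_a_numerical_radius by simp
  qed

  have N4: "4 * N\<^sup>2 \<le> S\<^sup>2 - D\<^sup>2"
  proof -
    have "N\<^sup>2 \<le> (\<Sum>j\<in>J. p j * (nrm (X j))\<^sup>2) * (\<Sum>j\<in>J. p j * (nrm (Y j))\<^sup>2)" (is "_ \<le> ?A * ?B")
      unfolding N_def using p(1) by (rule weighted_Cauchy_Schwarz)
    moreover have "S = ?A + ?B" "D = ?A - ?B"
      unfolding S_def D_def by (simp_all add: distrib_left right_diff_distrib sum.distrib sum_subtractf)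
    moreover have "(?A + ?B)\<^sup>2 - (?A - ?B)\<^sup>2 = 4 * (?A * ?B)"
      by (simp add: power2_eq_square algebra_simps)
    ultimately show ?thesis by simp
  qed
  have S0: "S \<ge> 0" unfolding S_def by (intro sum_nonneg mult_nonneg_nonneg p) auto
  \<comment> \<open>Cauchy--Schwarz against 1 bounds \<open>\<phi> (a * z)\<close> by
    \<open>nrm z\<close>, hence by the seminorm; at \<open>z = (X j)\<^sup>2 + (Y j)\<^sup>2\<close>
    this value is the factor next to \<open>p j\<close> in \<open>S\<close>.\<close>
  have ST: "S \<le> (\<Sum>j\<in>J. p j * a_seminorm a ((X j)\<^sup>2 + (Y j)\<^sup>2))"
    unfolding S_def
  proof (intro sum_mono mult_left_mono p(1))
    fix j assume j: "j \<in> J"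
    have "is_a_adjoint a ((X j)\<^sup>2 + (Y j)\<^sup>2) ((X j)\<^sup>2 + (Y j)\<^sup>2)"
      by (intro is_a_adjoint_add is_a_adjoint_power XX YY j)
    then have "cmod (\<phi> (a * ((X j)\<^sup>2 + (Y j)\<^sup>2))) \<le> a_seminorm a ((X j)\<^sup>2 + (Y j)\<^sup>2)"
      using cmod_le_nrm nrm_le_a_seminorm order_trans by blast
    moreover have "\<phi> (a * ((X j)\<^sup>2 + (Y j)\<^sup>2)) = of_real ((nrm (X j))\<^sup>2 + (nrm (Y j))\<^sup>2)"
      by (simp only: distrib_left add nX[OF j] nY[OF j] of_real_add)
    ultimately show "(nrm (X j))\<^sup>2 + (nrm (Y j))\<^sup>2 \<le> a_seminorm a ((X j)\<^sup>2 + (Y j)\<^sup>2)"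
      by (simp only: norm_of_real)
  qed
  have cD: "a_crawford_number a (\<Sum>j\<in>J. p j *\<^sub>R ((X j)\<^sup>2 - (Y j)\<^sup>2)) \<le> \<bar>D\<bar>"
  proof -
    \<comment> \<open>\<open>D\<close> is itself a point of the numerical range, so its modulus is
      among the numbers whose infimum is the Crawford number.\<close>
    have "\<phi> (a * (\<Sum>j\<in>J. p j *\<^sub>R ((X j)\<^sup>2 - (Y j)\<^sup>2))) = of_real D"
      unfolding lin D_def of_real_sum
    proof (intro sum.cong refl)
      fix j assume j: "j \<in> J"
      show "p j *\<^sub>R \<phi> (a * ((X j)\<^sup>2 - (Y j)\<^sup>2)) = of_real (p j * ((nrm (X j))\<^sup>2 - (nrm (Y j))\<^sup>2))"
        by (simp only: right_diff_distrib diff nX[OF j] nY[OF j] of_real_diff of_real_mult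
            scaleR_conv_of_real)
    qed
    then show ?thesis using a_crawford_number_le by (metis norm_of_real)
  qed
  from combined_bound[OF norm_ge_zero wN wV L0 LWN \<mu> N4 S0 ST a_crawford_number_nonneg cD] LHS
  show ?thesis unfolding X_def Y_def by linarith
qed

section \<open>Passage to the supremum over states\<close>

theorem theorem3p13:
  fixes a :: "'a::unital_cstar_algebra"
    and k :: nat
    and x y x' y' :: "nat \<Rightarrow> 'a"
    and \<mu> :: real
    and p :: "nat \<Rightarrow> real"
  assumes "positive_element a" and "a \<noteq> 0"
    and "k \<ge> 1"
    and "\<And>j. j \<in> {1..k} \<Longrightarrow> x j \<in> a_adjointable a"
    and "\<And>j. j \<in> {1..k} \<Longrightarrow> y j \<in> a_adjointable a"
    and "\<And>j. j \<in> {1..k} \<Longrightarrow> is_a_adjoint a (x j) (x' j)"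
    and "\<And>j. j \<in> {1..k} \<Longrightarrow> is_a_adjoint a (y j) (y' j)"
    and "\<mu> \<ge> 0"
    and "\<And>j. j \<in> {1..k} \<Longrightarrow> p j \<ge> 0"
    and "(\<Sum>j=1..k. p j) = 1"
  shows "(a_numerical_radius a (\<Sum>j=1..k. p j *\<^sub>R (x' j * y j))) ^ 4
    \<le> 1 / (2 * (1 + \<mu>)) *
        (a_numerical_radius a (\<Sum>j=1..k. p j *\<^sub>R (y' j * y j * x' j * x j)))\<^sup>2
      + (1 + 2 * \<mu>) / (8 * (1 + \<mu>)) *
        (\<Sum>j=1..k. p j * a_seminorm a ((x' j * x j)\<^sup>2 + (y' j * y j)\<^sup>2))\<^sup>2
      - 1 / 8 *
        (a_crawford_number a (\<Sum>j=1..k. p j *\<^sub>R ((x' j * x j)\<^sup>2 - (y' j * y j)\<^sup>2)))\<^sup>2"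
    (is "a_numerical_radius a ?z ^ 4 \<le> ?R")
proof -
  have a: "psd a" using assms(1) by (rule positive_element_imp_psd)
  have bound: "cmod (\<phi> (a * ?z)) ^ 4 \<le> ?R" if "\<phi> \<in> a_states a" for \<phi>
  proof -
    interpret a_state a \<phi> using a that by unfold_locales
    show ?thesis using assms(6-10) by (rule a_state_bound)
  qed
  \<comment> \<open>One state makes the set under the supremum non-empty and shows
    \<open>?R \<ge> 0\<close>, which the subtracted term leaves unclear.\<close>
  obtain \<phi> where \<phi>: "\<phi> \<in> a_states a"
    using a_states_nonempty[OF a assms(2)] by blast
  then interpret a_state a \<phi> using a by unfold_locales
  have "is_a_adjoint a ?z (\<Sum>j=1..k. p j *\<^sub>R (y' j * x j))"
    by (intro is_a_adjoint_sum is_a_adjoint_scaleR is_a_adjoint_mult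
        is_a_adjoint_sym[OF star_a assms(6)] assms(7))
  then have nonneg: "a_numerical_radius a ?z \<ge> 0"
    using cmod_le_a_numerical_radius norm_ge_zero order_trans by blast
  \<comment> \<open>\<open>?R\<close> is independent of the state, so its fourth root bounds all
    moduli and hence their supremum.\<close>
  have "a_numerical_radius a ?z \<le> root 4 ?R"
    unfolding a_numerical_radius_def[of a ?z]
  proof (rule cSup_least)
    show "{cmod z | z. z \<in> a_numerical_range a ?z} \<noteq> {}"
      unfolding a_numerical_range_def using \<phi> by blast
    fix t assume "t \<in> {cmod z | z. z \<in> a_numerical_range a ?z}"
    then obtain \<psi> where \<psi>: "\<psi> \<in> a_states a" "t = cmod (\<psi> (a * ?z))"
      unfolding a_numerical_range_def by blast
    have "root 4 (cmod (\<psi> (a * ?z)) ^ 4) \<le> root 4 ?R"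
      by (rule real_root_le_mono[OF _ bound[OF \<psi>(1)]]) simp
    then show "t \<le> root 4 ?R"
      unfolding \<psi>(2) by (simp only: real_root_power_cancel zero_less_numeral norm_ge_zero)
  qed
  then have "a_numerical_radius a ?z ^ 4 \<le> root 4 ?R ^ 4"
    using nonneg by (rule power_mono)
  also have "root 4 ?R ^ 4 = ?R"
  proof (rule real_root_pow_pos2)
    show "?R \<ge> 0" using order_trans[OF zero_le_power[OF norm_ge_zero] bound[OF \<phi>]] .
  qed simp
  finally show ?thesis .
qed

end
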